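(* Let $\phi=\frac{1+\sqrt5}{2}$ be the golden ratio. Consider two point vortices in the half-plane, with interaction parameter $W$ and the types of motion described in the context. (i) For a vortex pair ($\Gamma_1=\Gamma_2=1$) the leap-frogging vortex motion changes to the smooth intertwining one through the cusp bifurcation, which occurs at the reciprocal golden ratio value of its interaction parameter: $W=1/\phi$. (ii) For a dipole ($\Gamma_1=-\Gamma_2=1$) the bifurcation from the kink motion to the laminar one occurs through the cusp bifurcation, corresponding to the golden ratio value of its interaction parameter: $W=\phi$. (iii) At the moment of cusp bifurcation the two vortices lie on the same vertical. The cross-ratio of the four points $(z_1,z_2,\bar z_2,\bar z_1)$, that are these two vortices together with their mirror images, is equal to the golden ratio $\phi$ (in both cases, for a vortex pair and a dipole).
   Context: Two point vortices of strengths $\Gamma_1,\Gamma_2$ in the half-plane $y>0$ are located at $z_1=(x_1,y_1)$ and $z_2=(x_2,y_2)$; their mirror images are $\bar z_1=(x_1,-y_1)$ and $\bar z_2=(x_2,-y_2)$, of strengths $-\Gamma_1$ and $-\Gamma_2$. The vortices move according to $$\Gamma_j\dot x_j=\frac{\partial\mathcal H}{\partial y_j},\qquad \Gamma_j\dot y_j=-\frac{\partial\mathcal H}{\partial x_j},\qquad j=1,2,$$ with Hamiltonian $$\mathcal H(z_1,z_2)=\frac1{4\pi}\Big(\Gamma_1^2\log|z_1-\bar z_1|+\Gamma_2^2\log|z_2-\bar z_2|-2\Gamma_1\Gamma_2\log|z_1-z_2|+2\Gamma_1\Gamma_2\log|z_1-\bar z_2|\Big).$$ The system is invariant under $x$-translations,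 with the corresponding Noether first integral $P:=\Gamma_1y_1+\Gamma_2y_2$. Vortices collide neither with each other nor with the boundary. A vortex pair is the case of strengths normalized to $\Gamma_1=\Gamma_2=1$; a dipole is the case $\Gamma_1=-\Gamma_2=1$. The dimensionless interaction parameter is $W:=P^2\exp(-4\pi\mathcal H)$; the increase of $W$ corresponds to the weakening of the interaction between the point vortices. The types of motion are understood descriptively. For a vortex pair, a strong interaction is related to a leap-frogging motion of the vortices, while a weak one produces two smooth intertwining sinusoidal-like trajectories. For a dipole, as the interaction weakens, upon approaching one another the vortices either go to infinity at a slanted asymptote, or one of them makes a kink with the other before parting (kink motion), or they pass each other at a distance (laminar motion). In both cases the change from the leap-frogging/kink motion to the regular one happens through a motion with a cusp (the cusp bifurcation); a cusp in a generic parametrized trajectory $t\mapsto(x(t),y(t))$ corresponds to a vanishing derivative $(\dot x(t),\dot y(t))=(0,0)$, i.e. an instantaneous stop of a vortex. The cross-ratio of four points on a line with coordinates $a,b,c,d$ is $\mathrm{CR}(a,b,c,d)=\dfrac{(a-d)(b-c)}{(a-b)(c-d)}$; for four points on a common vertical line the coordinate is the height $y$. *)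

theory Defs
  imports "HOL-Analysis.Analysis"
begin

definition golden_ratio :: real where
  "golden_ratio = (1 + sqrt 5) / 2"

definition vortex_hamiltonian :: "real \<Rightarrow> real \<Rightarrow> complex \<Rightarrow> complex \<Rightarrow> real" where
  "vortex_hamiltonian \<Gamma>1 \<Gamma>2 z1 z2 =
     1 / (4 * pi) *
       (\<Gamma>1\<^sup>2 * ln (cmod (z1 - cnj z1)) + \<Gamma>2\<^sup>2 * ln (cmod (z2 - cnj z2))
        - 2 * \<Gamma>1 * \<Gamma>2 * ln (cmod (z1 - z2)) + 2 * \<Gamma>1 * \<Gamma>2 * ln (cmod (z1 - cnj z2)))"

definition vortex_momentum :: "real \<Rightarrow> real \<Rightarrow> complex \<Rightarrow> complex \<Rightarrow> real" where
  "vortex_momentum \<Gamma>1 \<Gamma>2 z1 z2 = \<Gamma>1 * Im z1 + \<Gamma>2 * Im z2"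

definition interaction_parameter :: "real \<Rightarrow> real \<Rightarrow> complex \<Rightarrow> complex \<Rightarrow> real" where
  "interaction_parameter \<Gamma>1 \<Gamma>2 z1 z2 =
     (vortex_momentum \<Gamma>1 \<Gamma>2 z1 z2)\<^sup>2 * exp (- 4 * pi * vortex_hamiltonian \<Gamma>1 \<Gamma>2 z1 z2)"

definition partial_x :: "(complex \<Rightarrow> real) \<Rightarrow> complex \<Rightarrow> real" where
  "partial_x h z = deriv (\<lambda>x. h (Complex x (Im z))) (Re z)"

definition partial_y :: "(complex \<Rightarrow> real) \<Rightarrow> complex \<Rightarrow> real" where
  "partial_y h z = deriv (\<lambda>y. h (Complex (Re z) y)) (Im z)"

definition velocity :: "(real \<Rightarrow> complex) \<Rightarrow> real \<Rightarrow> complex" where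
  "velocity z t = vector_derivative z (at t)"

definition vortex_motion ::
    "real \<Rightarrow> real \<Rightarrow> (real \<Rightarrow> complex) \<Rightarrow> (real \<Rightarrow> complex) \<Rightarrow> bool" where
  "vortex_motion \<Gamma>1 \<Gamma>2 z1 z2 \<longleftrightarrow>
     (\<forall>t. Im (z1 t) > 0 \<and> Im (z2 t) > 0 \<and> z1 t \<noteq> z2 t \<and>
        z1 differentiable (at t) \<and> z2 differentiable (at t) \<and>
        \<Gamma>1 * Re (velocity z1 t) = partial_y (\<lambda>z. vortex_hamiltonian \<Gamma>1 \<Gamma>2 z (z2 t)) (z1 t) \<and>
        \<Gamma>1 * Im (velocity z1 t) = - partial_x (\<lambda>z. vortex_hamiltonian \<Gamma>1 \<Gamma>2 z (z2 t)) (z1 t) \<and>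
        \<Gamma>2 * Re (velocity z2 t) = partial_y (\<lambda>z. vortex_hamiltonian \<Gamma>1 \<Gamma>2 (z1 t) z) (z2 t) \<and>
        \<Gamma>2 * Im (velocity z2 t) = - partial_x (\<lambda>z. vortex_hamiltonian \<Gamma>1 \<Gamma>2 (z1 t) z) (z2 t))"

definition has_cusp :: "(real \<Rightarrow> complex) \<Rightarrow> (real \<Rightarrow> complex) \<Rightarrow> bool" where
  "has_cusp z1 z2 \<longleftrightarrow> (\<exists>t. velocity z1 t = 0 \<or> velocity z2 t = 0)"

text \<open>
  The types of motion are told apart by the shape of the individual trajectories and by the
  relative motion of the two vortices.  A trajectory with a loop or kink turns back on itself
  in the direction of the boundary; a regular, sinusoidal-like one never has a vertical tangent
  or a stop, hence is a smooth graph over the boundary.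
\<close>

definition turns_back :: "(real \<Rightarrow> complex) \<Rightarrow> bool" where
  "turns_back z \<longleftrightarrow> (\<exists>t. Re (velocity z t) > 0) \<and> (\<exists>t. Re (velocity z t) < 0)"

definition graph_like :: "(real \<Rightarrow> complex) \<Rightarrow> bool" where
  "graph_like z \<longleftrightarrow> (\<forall>t. Re (velocity z t) \<noteq> 0)"

text \<open>
  Each vortex is, again and again, ahead of and behind the other, and above and below it.
  This is common to leap-frogging and intertwining; it excludes the very weakly interacting
  pairs, whose vortices overtake each other at most once and separate to infinity.
\<close>

definition vortices_alternate :: "(real \<Rightarrow> complex) \<Rightarrow> (real \<Rightarrow> complex) \<Rightarrow> bool" where
  "vortices_alternate z1 z2 \<longleftrightarrow>
     (\<exists>\<^sub>F t in at_top. Re (z1 t) < Re (z2 t)) \<and> (\<exists>\<^sub>F t in at_top. Re (z2 t) < Re (z1 t)) \<and>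
     (\<exists>\<^sub>F t in at_top. Im (z1 t) < Im (z2 t)) \<and> (\<exists>\<^sub>F t in at_top. Im (z2 t) < Im (z1 t))"

definition leap_frogging :: "(real \<Rightarrow> complex) \<Rightarrow> (real \<Rightarrow> complex) \<Rightarrow> bool" where
  "leap_frogging z1 z2 \<longleftrightarrow> vortices_alternate z1 z2 \<and> turns_back z1 \<and> turns_back z2"

definition smooth_intertwining :: "(real \<Rightarrow> complex) \<Rightarrow> (real \<Rightarrow> complex) \<Rightarrow> bool" where
  "smooth_intertwining z1 z2 \<longleftrightarrow> vortices_alternate z1 z2 \<and> graph_like z1 \<and> graph_like z2"

text \<open>
  The vortices come from horizontally infinitely far apart, exchange their horizontal order
  and part.  This excludes the dipoles that leave together along a slanted asymptote.
\<close>

definition vortices_pass :: "(real \<Rightarrow> complex) \<Rightarrow> (real \<Rightarrow> complex) \<Rightarrow> bool" where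
  "vortices_pass z1 z2 \<longleftrightarrow>
     (filterlim (\<lambda>t. Re (z1 t) - Re (z2 t)) at_bot at_bot \<and>
      filterlim (\<lambda>t. Re (z1 t) - Re (z2 t)) at_top at_top) \<or>
     (filterlim (\<lambda>t. Re (z1 t) - Re (z2 t)) at_top at_bot \<and>
      filterlim (\<lambda>t. Re (z1 t) - Re (z2 t)) at_bot at_top)"

definition kink_motion :: "(real \<Rightarrow> complex) \<Rightarrow> (real \<Rightarrow> complex) \<Rightarrow> bool" where
  "kink_motion z1 z2 \<longleftrightarrow> vortices_pass z1 z2 \<and>
     (turns_back z1 \<and> graph_like z2 \<or> graph_like z1 \<and> turns_back z2)"

definition laminar_motion :: "(real \<Rightarrow> complex) \<Rightarrow> (real \<Rightarrow> complex) \<Rightarrow> bool" where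
  "laminar_motion z1 z2 \<longleftrightarrow> vortices_pass z1 z2 \<and> graph_like z1 \<and> graph_like z2"

definition cross_ratio :: "real \<Rightarrow> real \<Rightarrow> real \<Rightarrow> real \<Rightarrow> real" where
  "cross_ratio a b c d = ((a - d) * (b - c)) / ((a - b) * (c - d))"

end

theory Submission
  imports Defs
begin

text \<open>
  Write \<open>\<phi>\<close> for the golden ratio.  Replacing the second vortex of a dipole by its mirror image turns
  the dipole into a vortex pair, so both systems are one planar system in the horizontal distance
  \<open>X\<close> and the signed heights \<open>a\<close> and \<open>b\<close>, with \<open>b < 0\<close> for the dipole.  Put
  \<open>S = X\<^sup>2 + (a + b)\<^sup>2\<close>.  Two integrals of the motion are \<open>P = a + b\<close> and \<open>1 / (4 * a * b) - 1 / S\<close>, and the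
  latter times \<open>P\<^sup>2\<close> is \<open>W\<close> for the pair and \<open>- W\<close> for the dipole (lemmas \<open>momentum\<close>, \<open>energy\<close>,
  \<open>W_eq\<close>).  The horizontal velocity of the first vortex has the sign of
  \<open>S\<^sup>2 - 8 * P * a\<^sup>2 * b\<close>; for the second vortex \<open>a\<close> and \<open>b\<close> are exchanged, and the sign is reversed
  for the dipole.

  The vertical velocities vanish only for \<open>X = 0\<close>, that is \<open>S = P\<^sup>2\<close>, so a cusp can only occur
  on a common vertical.  There the numerator is \<open>P * (a - b) * (a\<^sup>2 - 4 * a * b - b\<^sup>2)\<close>, and
  \<open>W\<close> is the quotient \<open>(a - b)\<^sup>2 / (4 * a * b)\<close>, up to sign.  The last factor, or the one with \<open>a\<close> and
  \<open>b\<close> exchanged, vanishes exactly for \<open>W = 1 / \<phi>\<close> (pair) and \<open>W = \<phi>\<close> (dipole); this follows from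
  lemma \<open>cusp_ratio\<close> and gives the cross-ratio as well.  Below this value of \<open>W\<close> one of the vortices
  reverses its horizontal direction on the vertical; above it both keep their direction at all
  times, by the estimates \<open>pair_drift_bound\<close> and \<open>dipole_drift_bound\<close>, in which the quadratic form
  of the golden ratio appears as a factor.

  What remains is the global behaviour.  For a pair with \<open>W < 1\<close> the point with coordinates \<open>X\<close> and
  \<open>a - b\<close> circles for ever around the collision point (\<open>pair_alternate\<close>), and for \<open>W \<ge> 1\<close> the
  heights are never equal.  For a dipole with \<open>W > 1\<close> the distance \<open>X\<close> grows at a rate bounded
  below (\<open>dipole_pass\<close>), and for \<open>W \<le> 1\<close> it never vanishes.  Motions with every admissible value of
  \<open>W\<close> exist, because the level curves have explicit parametrizations, which reduces the system to
  a scalar autonomous equation.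
\<close>

section \<open>The equations of motion in real coordinates\<close>

lemma ln_cmod: "ln (cmod z) = ln ((Re z)\<^sup>2 + (Im z)\<^sup>2) / 2"
  by (cases "z = 0") (auto simp: cmod_def ln_sqrt complex_eq_iff sum_power2_gt_zero_iff)

lemma vortex_hamiltonian_real:
  "vortex_hamiltonian \<Gamma>1 \<Gamma>2 z c = 1 / (4 * pi) *
     (\<Gamma>1\<^sup>2 * ln ((2 * Im z)\<^sup>2) / 2 + \<Gamma>2\<^sup>2 * ln ((2 * Im c)\<^sup>2) / 2
      - \<Gamma>1 * \<Gamma>2 * ln ((Re z - Re c)\<^sup>2 + (Im z - Im c)\<^sup>2)
      + \<Gamma>1 * \<Gamma>2 * ln ((Re z - Re c)\<^sup>2 + (Im z + Im c)\<^sup>2))"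
  unfolding vortex_hamiltonian_def ln_cmod by simp

lemma vortex_hamiltonian_commute:
  "vortex_hamiltonian \<Gamma>1 \<Gamma>2 z c = vortex_hamiltonian \<Gamma>2 \<Gamma>1 c z"
  unfolding vortex_hamiltonian_real
  by (simp add: power2_commute[of "Re z"] power2_commute[of "Im z"] add.commute mult.commute)

lemma vortex_distances_pos:
  assumes "Im z > 0" "Im c > 0" "z \<noteq> c"
  shows "(Re z - Re c)\<^sup>2 + (Im z - Im c)\<^sup>2 > 0" "(Re z - Re c)\<^sup>2 + (Im z + Im c)\<^sup>2 > 0"
  using assms by (auto simp: sum_power2_gt_zero_iff complex_eq_iff)

lemma has_real_derivative_weighted_sum:
  assumes "(f has_real_derivative f') (at x)" "(g has_real_derivative g') (at x)"
    "(h has_real_derivative h') (at x)"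
  shows "((\<lambda>x. k * (p * f x / 2 + q - r * g x + r * h x)) has_real_derivative
           k * (p * f' / 2 - r * g' + r * h')) (at x)"
  by (rule derivative_eq_intros assms refl | simp)+

lemma partial_y_vortex_hamiltonian:
  assumes "Im z > 0" "Im c > 0" "z \<noteq> c"
  shows "partial_y (\<lambda>z. vortex_hamiltonian \<Gamma>1 \<Gamma>2 z c) z = 1 / (4 * pi) *
    (\<Gamma>1\<^sup>2 / Im z - 2 * \<Gamma>1 * \<Gamma>2 * (Im z - Im c) / ((Re z - Re c)\<^sup>2 + (Im z - Im c)\<^sup>2)
     + 2 * \<Gamma>1 * \<Gamma>2 * (Im z + Im c) / ((Re z - Re c)\<^sup>2 + (Im z + Im c)\<^sup>2))"
  unfolding partial_y_def
proof (rule DERIV_imp_deriv, unfold vortex_hamiltonian_real complex.sel)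
  note pos = vortex_distances_pos[OF assms]
  show "((\<lambda>y. 1 / (4 * pi) * (\<Gamma>1\<^sup>2 * ln ((2 * y)\<^sup>2) / 2 + \<Gamma>2\<^sup>2 * ln ((2 * Im c)\<^sup>2) / 2
      - \<Gamma>1 * \<Gamma>2 * ln ((Re z - Re c)\<^sup>2 + (y - Im c)\<^sup>2)
      + \<Gamma>1 * \<Gamma>2 * ln ((Re z - Re c)\<^sup>2 + (y + Im c)\<^sup>2))) has_real_derivative
    1 / (4 * pi) *
    (\<Gamma>1\<^sup>2 / Im z - 2 * \<Gamma>1 * \<Gamma>2 * (Im z - Im c) / ((Re z - Re c)\<^sup>2 + (Im z - Im c)\<^sup>2)
     + 2 * \<Gamma>1 * \<Gamma>2 * (Im z + Im c) / ((Re z - Re c)\<^sup>2 + (Im z + Im c)\<^sup>2))) (at (Im z))"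
  proof (rule DERIV_cong[OF has_real_derivative_weighted_sum])
    show "((\<lambda>y. ln ((2 * y)\<^sup>2)) has_real_derivative 2 / Im z) (at (Im z))"
      using assms(1) by (auto intro!: derivative_eq_intros simp: power2_eq_square)
    show "((\<lambda>y. ln ((Re z - Re c)\<^sup>2 + (y - Im c)\<^sup>2)) has_real_derivative
        2 * (Im z - Im c) / ((Re z - Re c)\<^sup>2 + (Im z - Im c)\<^sup>2)) (at (Im z))"
      "((\<lambda>y. ln ((Re z - Re c)\<^sup>2 + (y + Im c)\<^sup>2)) has_real_derivative
        2 * (Im z + Im c) / ((Re z - Re c)\<^sup>2 + (Im z + Im c)\<^sup>2)) (at (Im z))"
      using pos by (auto intro!: derivative_eq_intros)
  qed (simp add: mult_ac)
qed

lemma partial_x_vortex_hamiltonian: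
  assumes "Im z > 0" "Im c > 0" "z \<noteq> c"
  shows "partial_x (\<lambda>z. vortex_hamiltonian \<Gamma>1 \<Gamma>2 z c) z = 1 / (4 * pi) *
    (- 2 * \<Gamma>1 * \<Gamma>2 * (Re z - Re c) / ((Re z - Re c)\<^sup>2 + (Im z - Im c)\<^sup>2)
     + 2 * \<Gamma>1 * \<Gamma>2 * (Re z - Re c) / ((Re z - Re c)\<^sup>2 + (Im z + Im c)\<^sup>2))"
  unfolding partial_x_def
proof (rule DERIV_imp_deriv, unfold vortex_hamiltonian_real complex.sel)
  note pos = vortex_distances_pos[OF assms]
  show "((\<lambda>x. 1 / (4 * pi) * (\<Gamma>1\<^sup>2 * ln ((2 * Im z)\<^sup>2) / 2 + \<Gamma>2\<^sup>2 * ln ((2 * Im c)\<^sup>2) / 2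
      - \<Gamma>1 * \<Gamma>2 * ln ((x - Re c)\<^sup>2 + (Im z - Im c)\<^sup>2)
      + \<Gamma>1 * \<Gamma>2 * ln ((x - Re c)\<^sup>2 + (Im z + Im c)\<^sup>2))) has_real_derivative
    1 / (4 * pi) *
    (- 2 * \<Gamma>1 * \<Gamma>2 * (Re z - Re c) / ((Re z - Re c)\<^sup>2 + (Im z - Im c)\<^sup>2)
     + 2 * \<Gamma>1 * \<Gamma>2 * (Re z - Re c) / ((Re z - Re c)\<^sup>2 + (Im z + Im c)\<^sup>2))) (at (Re z))"
  proof (rule DERIV_cong[OF has_real_derivative_weighted_sum])
    show "((\<lambda>x. ln ((2 * Im z)\<^sup>2)) has_real_derivative 0) (at (Re z))"
      by simp
    show "((\<lambda>x. ln ((x - Re c)\<^sup>2 + (Im z - Im c)\<^sup>2)) has_real_derivative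
        2 * (Re z - Re c) / ((Re z - Re c)\<^sup>2 + (Im z - Im c)\<^sup>2)) (at (Re z))"
      "((\<lambda>x. ln ((x - Re c)\<^sup>2 + (Im z + Im c)\<^sup>2)) has_real_derivative
        2 * (Re z - Re c) / ((Re z - Re c)\<^sup>2 + (Im z + Im c)\<^sup>2)) (at (Re z))"
      using pos by (auto intro!: derivative_eq_intros)
  qed (simp add: mult_ac)
qed

text \<open>
  A dipole is a vortex pair whose second vortex has been replaced by its mirror image.  For
  strengths \<open>1\<close> and \<open>\<sigma> = \<plusminus>1\<close> both systems are therefore described by the height \<open>a\<close> of the
  first vortex, the signed height \<open>b = \<sigma> * Im z2\<close> of the second and the horizontal
  distance \<open>X\<close>, with the same velocity field.  The horizontal velocity of the first vortex is
  \<open>drift a b X\<close> and that of the second \<open>drift b a X\<close>; the heights \<open>a\<close> and \<open>b\<close> change at the rates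
  \<open>climb a b X\<close> and \<open>- climb a b X\<close>.
\<close>

definition drift :: "real \<Rightarrow> real \<Rightarrow> real \<Rightarrow> real" where
  "drift a b X = ((X\<^sup>2 + (a + b)\<^sup>2)\<^sup>2 - 8 * (a + b) * a\<^sup>2 * b) /
     (4 * pi * a * (X\<^sup>2 + (a + b)\<^sup>2) * (X\<^sup>2 + (a - b)\<^sup>2))"

definition climb :: "real \<Rightarrow> real \<Rightarrow> real \<Rightarrow> real" where
  "climb a b X = 2 * X * a * b / (pi * (X\<^sup>2 + (a + b)\<^sup>2) * (X\<^sup>2 + (a - b)\<^sup>2))"

text \<open>
  The sum of the contributions of the vortex's own image, the other vortex and the image of the
  other vortex has a numerator of low degree; all later sign questions are about this numerator.
\<close>

lemma drift_identity:
  assumes "a \<noteq> 0" "X\<^sup>2 + (a + b)\<^sup>2 \<noteq> 0" "X\<^sup>2 + (a - b)\<^sup>2 \<noteq> 0"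
  shows "1 / (4 * pi) * (1 / a - 2 * (a - b) / (X\<^sup>2 + (a - b)\<^sup>2) + 2 * (a + b) / (X\<^sup>2 + (a + b)\<^sup>2))
     = drift a b X"
proof -
  define S where "S = X\<^sup>2 + (a + b)\<^sup>2"
  have D: "X\<^sup>2 + (a - b)\<^sup>2 = S - 4 * a * b"
    unfolding S_def by (simp add: power2_eq_square algebra_simps)
  have "1 / a - 2 * (a - b) / (S - 4 * a * b) + 2 * (a + b) / S
    = (S\<^sup>2 - 8 * (a + b) * a\<^sup>2 * b) / (a * S * (S - 4 * a * b))"
    using assms unfolding D S_def[symmetric] by (simp add: field_simps power2_eq_square)
  then show ?thesis
    unfolding drift_def D S_def[symmetric] by (simp add: mult.assoc)
qed

lemma climb_identity:
  assumes "X\<^sup>2 + (a + b)\<^sup>2 \<noteq> 0" "X\<^sup>2 + (a - b)\<^sup>2 \<noteq> 0"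
  shows "1 / (4 * pi) * (2 * X / (X\<^sup>2 + (a - b)\<^sup>2) - 2 * X / (X\<^sup>2 + (a + b)\<^sup>2)) = climb a b X"
proof -
  define S where "S = X\<^sup>2 + (a + b)\<^sup>2"
  have D: "X\<^sup>2 + (a - b)\<^sup>2 = S - 4 * a * b"
    unfolding S_def by (simp add: power2_eq_square algebra_simps)
  have "2 * X / (S - 4 * a * b) - 2 * X / S = 8 * X * a * b / (S * (S - 4 * a * b))"
    using assms unfolding D S_def[symmetric] by (simp add: field_simps power2_eq_square)
  then show ?thesis
    unfolding climb_def D S_def[symmetric] by (simp add: mult.assoc)
qed

lemma drift_diff:
  assumes "a \<noteq> 0" "b \<noteq> 0" "X\<^sup>2 + (a + b)\<^sup>2 \<noteq> 0" "X\<^sup>2 + (a - b)\<^sup>2 \<noteq> 0"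
  shows "drift a b X - drift b a X
    = - (a - b) * (X\<^sup>2 + (a + b)\<^sup>2) / (4 * pi * a * b * (X\<^sup>2 + (a - b)\<^sup>2))"
proof -
  define S where "S = X\<^sup>2 + (a + b)\<^sup>2"
  define D where "D = X\<^sup>2 + (a - b)\<^sup>2"
  have c: "b + a = a + b" "(b - a)\<^sup>2 = (a - b)\<^sup>2" by (auto simp: power2_commute)
  have "drift a b X - drift b a X
      = (b * (S\<^sup>2 - 8 * (a + b) * a\<^sup>2 * b) - a * (S\<^sup>2 - 8 * (a + b) * b\<^sup>2 * a)) / (4 * pi * a * b * S * D)"
    unfolding drift_def c S_def[symmetric] D_def[symmetric]
    using assms S_def[symmetric] D_def[symmetric] by (simp add: divide_simps)
  also have "b * (S\<^sup>2 - 8 * (a + b) * a\<^sup>2 * b) - a * (S\<^sup>2 - 8 * (a + b) * b\<^sup>2 * a) = - (a - b) * S * S"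
    by (simp add: power2_eq_square algebra_simps)
  finally show ?thesis
    using assms unfolding S_def[symmetric] D_def[symmetric] by simp
qed

lemma separations_pos:
  assumes "\<sigma> = 1 \<or> \<sigma> = - 1" "Im z1 > 0" "Im z2 > 0" "z1 \<noteq> z2"
  shows "(Re z1 - Re z2)\<^sup>2 + (Im z1 + \<sigma> * Im z2)\<^sup>2 > 0" "(Re z1 - Re z2)\<^sup>2 + (Im z1 - \<sigma> * Im z2)\<^sup>2 > 0"
  using assms vortex_distances_pos[of z1 z2] by auto

lemma vortex_motion_iff:
  assumes \<sigma>: "\<sigma> = 1 \<or> \<sigma> = - 1"
  shows "vortex_motion 1 \<sigma> z1 z2 \<longleftrightarrow>
    (\<forall>t. Im (z1 t) > 0 \<and> Im (z2 t) > 0 \<and> z1 t \<noteq> z2 t \<and>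
      z1 differentiable (at t) \<and> z2 differentiable (at t) \<and>
      velocity z1 t = Complex (drift (Im (z1 t)) (\<sigma> * Im (z2 t)) (Re (z1 t) - Re (z2 t)))
                              (climb (Im (z1 t)) (\<sigma> * Im (z2 t)) (Re (z1 t) - Re (z2 t))) \<and>
      velocity z2 t = Complex (drift (\<sigma> * Im (z2 t)) (Im (z1 t)) (Re (z1 t) - Re (z2 t)))
                              (- \<sigma> * climb (Im (z1 t)) (\<sigma> * Im (z2 t)) (Re (z1 t) - Re (z2 t))))"
proof -
  have
    "1 * Re v1 = partial_y (\<lambda>z. vortex_hamiltonian 1 \<sigma> z c2) c1 \<and>
     1 * Im v1 = - partial_x (\<lambda>z. vortex_hamiltonian 1 \<sigma> z c2) c1 \<and>
     \<sigma> * Re v2 = partial_y (\<lambda>z. vortex_hamiltonian 1 \<sigma> c1 z) c2 \<and>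
     \<sigma> * Im v2 = - partial_x (\<lambda>z. vortex_hamiltonian 1 \<sigma> c1 z) c2 \<longleftrightarrow>
     v1 = Complex (drift (Im c1) (\<sigma> * Im c2) (Re c1 - Re c2)) (climb (Im c1) (\<sigma> * Im c2) (Re c1 - Re c2)) \<and>
     v2 = Complex (drift (\<sigma> * Im c2) (Im c1) (Re c1 - Re c2)) (- \<sigma> * climb (Im c1) (\<sigma> * Im c2) (Re c1 - Re c2))"
    if pos: "Im c1 > 0" "Im c2 > 0" "c1 \<noteq> c2" for c1 c2 v1 v2
  proof -
    let ?a = "Im c1" and ?b = "\<sigma> * Im c2" and ?X = "Re c1 - Re c2"
    have ne: "?X\<^sup>2 + (?a + ?b)\<^sup>2 \<noteq> 0" "?X\<^sup>2 + (?a - ?b)\<^sup>2 \<noteq> 0"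
        "?X\<^sup>2 + (?b + ?a)\<^sup>2 \<noteq> 0" "?X\<^sup>2 + (?b - ?a)\<^sup>2 \<noteq> 0"
      using separations_pos[OF \<sigma> pos] by (auto simp: add.commute power2_commute)
    define D S where "D = ?X\<^sup>2 + (Im c1 - Im c2)\<^sup>2" and "S = ?X\<^sup>2 + (Im c1 + Im c2)\<^sup>2"
    have sq: "(Re c2 - Re c1)\<^sup>2 = ?X\<^sup>2" "(Im c2 - Im c1)\<^sup>2 = (Im c1 - Im c2)\<^sup>2"
      "(Im c2 + Im c1)\<^sup>2 = (Im c1 + Im c2)\<^sup>2" "(- Im c2 + Im c1)\<^sup>2 = (Im c1 - Im c2)\<^sup>2"
      "(- Im c2 - Im c1)\<^sup>2 = (Im c1 + Im c2)\<^sup>2"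
      by (auto simp: power2_eq_square algebra_simps)
    have neg: "(- (2 * Im c1) - 2 * Im c2) / r = - ((2 * Im c1 + 2 * Im c2) / r)"
      "(2 * Im c2 - 2 * Im c1) / r = - ((2 * Im c1 - 2 * Im c2) / r)"
      "(2 * Re c2 - 2 * Re c1) / r = - ((2 * Re c1 - 2 * Re c2) / r)"
      "- ((p - q) / (4 * pi)) = (q - p) / (4 * pi)" for p q r
      unfolding minus_divide_left by simp_all
    note dist = sq D_def[symmetric] S_def[symmetric]
    have "partial_y (\<lambda>z. vortex_hamiltonian 1 \<sigma> z c2) c1 = drift ?a ?b ?X"
      unfolding partial_y_vortex_hamiltonian[OF pos] using \<sigma> ne pos
      by (subst drift_identity[symmetric]) (auto simp: dist neg)
    moreover have "- partial_x (\<lambda>z. vortex_hamiltonian 1 \<sigma> z c2) c1 = climb ?a ?b ?X"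
      unfolding partial_x_vortex_hamiltonian[OF pos] using \<sigma> ne pos
      by (subst climb_identity[symmetric]) (auto simp: dist neg)
    moreover have "partial_y (\<lambda>z. vortex_hamiltonian 1 \<sigma> c1 z) c2 = \<sigma> * drift ?b ?a ?X"
      unfolding vortex_hamiltonian_commute[of 1 \<sigma>]
        partial_y_vortex_hamiltonian[OF pos(2,1) pos(3)[symmetric]] using \<sigma> ne pos
      by (subst drift_identity[symmetric]) (auto simp: dist neg)
    moreover have "- partial_x (\<lambda>z. vortex_hamiltonian 1 \<sigma> c1 z) c2 = - climb ?a ?b ?X"
      unfolding vortex_hamiltonian_commute[of 1 \<sigma>]
        partial_x_vortex_hamiltonian[OF pos(2,1) pos(3)[symmetric]] using \<sigma> ne pos
      by (subst climb_identity[symmetric]) (auto simp: dist neg)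
    ultimately show ?thesis
      using \<sigma> by (auto simp: complex_eq_iff)
  qed
  then show ?thesis
    unfolding vortex_motion_def by blast
qed

section \<open>Where the golden ratio enters\<close>

lemma sgn_eqI:
  fixes x y :: real
  assumes "x < 0 \<longleftrightarrow> y < 0" "x = 0 \<longleftrightarrow> y = 0"
  shows "sgn x = sgn y"
  using assms by (auto simp: sgn_if)

lemma golden_ratio_gt_1: "golden_ratio > 1"
  unfolding golden_ratio_def using real_less_rsqrt[of 2 5] by simp

lemma golden_ratio_square: "golden_ratio\<^sup>2 = golden_ratio + 1"
  unfolding golden_ratio_def by (simp add: power2_eq_square field_simps)

lemma inverse_golden_ratio: "1 / golden_ratio = golden_ratio - 1"
  using golden_ratio_square golden_ratio_gt_1 by (simp add: field_simps power2_eq_square)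

text \<open>
  The quadratic form \<open>S\<^sup>2 - n * S - n\<^sup>2\<close> vanishes when \<open>S / n\<close> is the golden ratio.
  It turns up as a factor in the two estimates below.
\<close>

lemma golden_quadratic:
  "S\<^sup>2 - n * S - n\<^sup>2 = (S - golden_ratio * n) * (S + (golden_ratio - 1) * n)"
proof -
  have "(S - golden_ratio * n) * (S + (golden_ratio - 1) * n)
      = S\<^sup>2 - n * S - (golden_ratio\<^sup>2 - golden_ratio) * n\<^sup>2"
    by (simp add: power2_eq_square algebra_simps)
  then show ?thesis by (simp add: golden_ratio_square)
qed

text \<open>
  The numerator of the drift of a vortex pair is nonnegative as long as \<open>S \<ge> \<phi> * 4 * a * b\<close>.
  With \<open>n = 4 * a * b\<close> and \<open>R = (a + b)\<^sup>2\<close> the claim is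
  \<open>n * (a + b) * (a - b) \<le> S\<^sup>2 - n * R\<close>.  After squaring, \<open>(a - b)\<^sup>2 = R - n\<close> makes it affine in
  \<open>R\<close>, so that the worst case is \<open>R = S\<close>, where the difference factors as
  \<open>S * (S - n) * (S\<^sup>2 - n * S - n\<^sup>2)\<close>.
\<close>

lemma pair_drift_bound:
  assumes pos: "a > 0" "b > 0" and S: "(a + b)\<^sup>2 \<le> S" and g: "golden_ratio * (4 * a * b) \<le> S"
  shows "8 * (a + b) * a\<^sup>2 * b \<le> S\<^sup>2"
    and "golden_ratio * (4 * a * b) < S \<Longrightarrow> 8 * (a + b) * a\<^sup>2 * b < S\<^sup>2"
proof -
  define n R where "n = 4 * a * b" and "R = (a + b)\<^sup>2"
  have n: "n > 0" and R: "R > 0" "R \<le> S" and S0: "S > 0"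
    using pos S by (auto simp: n_def R_def intro: less_le_trans[of 0 "(a + b)\<^sup>2"])
  have gn: "golden_ratio * n \<le> S" using g by (simp add: n_def)
  then have nS: "n < S"
    using n golden_ratio_gt_1 mult_strict_right_mono[of 1 golden_ratio n] by linarith
  have factor: "S + (golden_ratio - 1) * n > 0"
    using n S0 golden_ratio_gt_1 by (intro add_pos_pos) auto
  have s2: "(a - b)\<^sup>2 = R - n"
    unfolding n_def R_def by (simp add: power2_eq_square algebra_simps)
  have eq: "8 * (a + b) * a\<^sup>2 * b = n * R + n * ((a + b) * (a - b))"
    unfolding n_def R_def by (simp add: power2_eq_square algebra_simps)
  have "(S\<^sup>2 - n * R)\<^sup>2 - (n * ((a + b) * (a - b)))\<^sup>2 = S ^ 4 - R * (n * (2 * S\<^sup>2 - n\<^sup>2))"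
    unfolding power_mult_distrib s2 R_def[symmetric]
    by (simp add: power2_eq_square power4_eq_xxxx algebra_simps)
  moreover have "R * (n * (2 * S\<^sup>2 - n\<^sup>2)) \<le> S * (n * (2 * S\<^sup>2 - n\<^sup>2))"
  proof (rule mult_right_mono)
    have "n\<^sup>2 \<le> S\<^sup>2" using nS n by (simp add: power_mono)
    moreover have "0 \<le> S\<^sup>2" by simp
    ultimately have "0 \<le> 2 * S\<^sup>2 - n\<^sup>2" by linarith
    then show "0 \<le> n * (2 * S\<^sup>2 - n\<^sup>2)" using n by simp
  qed (use R in simp)
  moreover have "S ^ 4 - S * (n * (2 * S\<^sup>2 - n\<^sup>2)) = S * (S - n) * (S\<^sup>2 - n * S - n\<^sup>2)"
    by (simp add: power2_eq_square power4_eq_xxxx algebra_simps)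
  ultimately have key: "(S\<^sup>2 - n * R)\<^sup>2 - (n * ((a + b) * (a - b)))\<^sup>2
      \<ge> S * (S - n) * ((S - golden_ratio * n) * (S + (golden_ratio - 1) * n))"
    unfolding golden_quadratic by linarith
  have nR: "0 \<le> S\<^sup>2 - n * R"
    using mult_mono[of n S R S] nS R n S0 by (simp add: power2_eq_square)
  have "0 \<le> S * (S - n) * ((S - golden_ratio * n) * (S + (golden_ratio - 1) * n))"
    using nS S0 gn factor by (intro mult_nonneg_nonneg) auto
  with key have "(n * ((a + b) * (a - b)))\<^sup>2 \<le> (S\<^sup>2 - n * R)\<^sup>2"
    by linarith
  from power2_le_imp_le[OF this nR] show "8 * (a + b) * a\<^sup>2 * b \<le> S\<^sup>2"
    unfolding eq by simp
  assume "golden_ratio * (4 * a * b) < S"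
  then have "0 < S * (S - n) * ((S - golden_ratio * n) * (S + (golden_ratio - 1) * n))"
    using nS S0 factor by (intro mult_pos_pos) (auto simp: n_def)
  with key have "(n * ((a + b) * (a - b)))\<^sup>2 < (S\<^sup>2 - n * R)\<^sup>2"
    by linarith
  from power2_less_imp_less[OF this nR] show "8 * (a + b) * a\<^sup>2 * b < S\<^sup>2"
    unfolding eq by simp
qed

text \<open>
  The same estimate with \<open>b\<close> replaced by \<open>- b\<close>, for the true heights \<open>a\<close> and \<open>b\<close> of a dipole:
  now \<open>R = (a - b)\<^sup>2\<close>, and the condition is that \<open>n = 4 * a * b\<close> is at most \<open>\<phi> * S\<close>.
\<close>

lemma dipole_drift_bound:
  assumes pos: "a > 0" "b > 0" and S: "(a - b)\<^sup>2 \<le> S" "S > 0" and g: "4 * a * b \<le> golden_ratio * S"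
  shows "8 * (a - b) * a * b\<^sup>2 \<le> S\<^sup>2"
    and "4 * a * b < golden_ratio * S \<Longrightarrow> 8 * (a - b) * a * b\<^sup>2 < S\<^sup>2"
proof -
  define n R where "n = 4 * a * b" and "R = (a - b)\<^sup>2"
  have n: "n > 0" and R: "R \<ge> 0" "R \<le> S"
    using pos S by (auto simp: n_def R_def)
  have p2: "(a + b)\<^sup>2 = R + n"
    unfolding n_def R_def by (simp add: power2_eq_square algebra_simps)
  have eq: "8 * (a - b) * a * b\<^sup>2 = n * ((a - b) * (a + b)) - n * R"
    unfolding n_def R_def by (simp add: power2_eq_square algebra_simps)
  have nR: "0 \<le> S\<^sup>2 + n * R" using n R by simp
  have diff: "(S\<^sup>2 + n * R)\<^sup>2 - (n * ((a - b) * (a + b)))\<^sup>2 = S ^ 4 - R * (n * (n\<^sup>2 - 2 * S\<^sup>2))"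
    unfolding power_mult_distrib p2 R_def[symmetric]
    by (simp add: power2_eq_square power4_eq_xxxx algebra_simps)
  have cubic: "S ^ 4 - S * (n * (n\<^sup>2 - 2 * S\<^sup>2))
      = S * (S + n) * ((golden_ratio * S - n) * ((golden_ratio - 1) * S + n))"
  proof -
    have "(golden_ratio * S - n) * ((golden_ratio - 1) * S + n) = S\<^sup>2 + n * S - n\<^sup>2"
      using golden_quadratic[of n S] by (simp add: algebra_simps)
    then show ?thesis
      by (simp add: power2_eq_square power4_eq_xxxx algebra_simps)
  qed
  have factor: "(golden_ratio - 1) * S + n > 0"
    using n S(2) golden_ratio_gt_1 by (intro add_pos_pos) auto
  \<comment> \<open>A negative cubic term only helps; otherwise it is largest when \<open>R = S\<close>.\<close>
  have bound: "R * (n * (n\<^sup>2 - 2 * S\<^sup>2)) \<le> max 0 (S * (n * (n\<^sup>2 - 2 * S\<^sup>2)))"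
    using R mult_right_mono[of R S "n * (n\<^sup>2 - 2 * S\<^sup>2)"]
      mult_nonneg_nonpos[of R "n * (n\<^sup>2 - 2 * S\<^sup>2)"] by linarith
  have S4: "0 < S ^ 4" using S(2) by simp
  have "0 \<le> S * (S + n) * ((golden_ratio * S - n) * ((golden_ratio - 1) * S + n))"
    using S n g factor by (intro mult_nonneg_nonneg) (auto simp: n_def)
  with cubic bound diff S4 have "(n * ((a - b) * (a + b)))\<^sup>2 \<le> (S\<^sup>2 + n * R)\<^sup>2"
    by linarith
  from power2_le_imp_le[OF this nR] show "8 * (a - b) * a * b\<^sup>2 \<le> S\<^sup>2"
    unfolding eq by simp
  assume "4 * a * b < golden_ratio * S"
  then have "0 < S * (S + n) * ((golden_ratio * S - n) * ((golden_ratio - 1) * S + n))"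
    using S n factor by (intro mult_pos_pos) (auto simp: n_def)
  with cubic bound diff S4 have "(n * ((a - b) * (a + b)))\<^sup>2 < (S\<^sup>2 + n * R)\<^sup>2"
    by linarith
  from power2_less_imp_less[OF this nR] show "8 * (a - b) * a * b\<^sup>2 < S\<^sup>2"
    unfolding eq by simp
qed

text \<open>
  Of two vortices on a common vertical at true heights \<open>a > b\<close>, the upper one of a pair and the
  lower one of a dipole is at rest iff \<open>a\<^sup>2 - 4 * a * b - b\<^sup>2 = 0\<close>, that is \<open>a = (2 + sqrt 5) * b\<close>.  Here \<open>2 + sqrt 5\<close> is the cube of the
  golden ratio, and it is also the larger root of the quadratic equation for \<open>a / b\<close> behind the
  right-hand sides.
\<close>

lemma cusp_ratio:
  assumes "a > b" "b > 0"
  shows "a\<^sup>2 - 4 * a * b - b\<^sup>2 < 0 \<longleftrightarrow> (a - b)\<^sup>2 / (4 * a * b) < golden_ratio - 1"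
    and "a\<^sup>2 - 4 * a * b - b\<^sup>2 = 0 \<longleftrightarrow> (a - b)\<^sup>2 / (4 * a * b) = golden_ratio - 1"
proof -
  define k where "k = sqrt 5"
  have k2: "k * k = 5" and k: "2 < k" "k < 3"
    unfolding k_def using real_less_rsqrt[of 2 5] real_less_lsqrt[of 3 5] by auto
  have k2': "k * (k * x) = 5 * x" for x using k2 by (metis mult.assoc)
  have \<phi>: "golden_ratio - 1 = (k - 1) / 2"
    unfolding golden_ratio_def k_def by (simp add: field_simps)
  have m: "0 < 4 * a * b" using assms by simp
  have f1: "a\<^sup>2 - 4 * a * b - b\<^sup>2 = (a - (k + 2) * b) * (a + (k - 2) * b)"
    using k2 by (simp add: power2_eq_square algebra_simps k2')
  have f2: "(a - b)\<^sup>2 - 4 * a * b * ((k - 1) / 2) = (a - (k + 2) * b) * (a - (k - 2) * b)"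
    using k2 by (simp add: power2_eq_square field_simps k2')
  have p1: "a + (k - 2) * b > 0" using assms k by (intro add_pos_pos) auto
  have p2: "a - (k - 2) * b > 0"
    using assms k mult_strict_right_mono[of "k - 2" 1 b] by linarith
  have lt: "y / n < c \<longleftrightarrow> y - n * c < 0" and eq: "y / n = c \<longleftrightarrow> y - n * c = 0"
    if "0 < n" for y n c :: real
    using that by (auto simp: field_simps)
  show "a\<^sup>2 - 4 * a * b - b\<^sup>2 < 0 \<longleftrightarrow> (a - b)\<^sup>2 / (4 * a * b) < golden_ratio - 1"
    unfolding \<phi> lt[OF m] f1 f2 using p1 p2 by (simp add: mult_less_0_iff)
  show "a\<^sup>2 - 4 * a * b - b\<^sup>2 = 0 \<longleftrightarrow> (a - b)\<^sup>2 / (4 * a * b) = golden_ratio - 1"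
    unfolding \<phi> eq[OF m] f1 f2 using p1 p2 by auto
qed

section \<open>Reduced dynamics and first integrals\<close>

text \<open>
  The logarithms combine into one formula for both signs, because the two squared distances
  exchange their roles together with the sign \<open>\<sigma>\<close>.
\<close>

lemma exp_vortex_hamiltonian:
  assumes \<sigma>: "\<sigma> = 1 \<or> \<sigma> = - 1" and pos: "Im z1 > 0" "Im z2 > 0" "z1 \<noteq> z2"
  shows "exp (- 4 * pi * vortex_hamiltonian 1 \<sigma> z1 z2)
    = ((Re z1 - Re z2)\<^sup>2 + (Im z1 - \<sigma> * Im z2)\<^sup>2)
      / (4 * Im z1 * Im z2 * ((Re z1 - Re z2)\<^sup>2 + (Im z1 + \<sigma> * Im z2)\<^sup>2))"
proof -
  define D S where "D = (Re z1 - Re z2)\<^sup>2 + (Im z1 - Im z2)\<^sup>2"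
    and "S = (Re z1 - Re z2)\<^sup>2 + (Im z1 + Im z2)\<^sup>2"
  have DS: "D > 0" "S > 0" unfolding D_def S_def using vortex_distances_pos[OF pos] by auto
  have "- 4 * pi * vortex_hamiltonian 1 \<sigma> z1 z2
    = - ln (2 * Im z1) - ln (2 * Im z2) + \<sigma> * (ln D - ln S)"
    unfolding vortex_hamiltonian_real D_def[symmetric] S_def[symmetric]
    using \<sigma> pos ln_realpow[of "2 * Im z1" 2] ln_realpow[of "2 * Im z2" 2] by auto
  also have "exp \<dots> = exp (\<sigma> * (ln D - ln S)) / (2 * Im z1 * (2 * Im z2))"
    using pos by (simp add: exp_add exp_diff exp_minus field_simps)
  also have "exp (\<sigma> * (ln D - ln S)) = (if \<sigma> = 1 then D / S else S / D)"
    using \<sigma> DS by (auto simp: exp_diff)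
  finally show ?thesis
    using \<sigma> unfolding D_def S_def by auto
qed

text \<open>
  A motion of two vortices of strengths \<open>1\<close> and \<open>\<sigma>\<close>, where \<open>\<sigma> = 1\<close> is the vortex pair and
  \<open>\<sigma> = - 1\<close> the dipole.
\<close>

locale mirror_motion =
  fixes \<sigma> :: real and z1 z2 :: "real \<Rightarrow> complex"
  assumes \<sigma>: "\<sigma> = 1 \<or> \<sigma> = - 1"
    and motion: "vortex_motion 1 \<sigma> z1 z2"
begin

text \<open>
  The reduced coordinates are the height \<open>a\<close> of the first vortex, the height \<open>b\<close> of the second
  one with the sign of its strength, and the horizontal distance \<open>X\<close>.  \<open>S\<close> and \<open>D\<close> are the
  squared distances to the other vortex and to its image: for a pair \<open>D\<close> is the distance to
  the vortex, for a dipole it is \<open>S\<close>.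
\<close>

definition a where "a t = Im (z1 t)"
definition b where "b t = \<sigma> * Im (z2 t)"
definition X where "X t = Re (z1 t) - Re (z2 t)"
definition S where "S t = (X t)\<^sup>2 + (a t + b t)\<^sup>2"
definition D where "D t = (X t)\<^sup>2 + (a t - b t)\<^sup>2"
text \<open>The interaction parameter along the motion; it is constant, see \<open>W_eq\<close>.\<close>

definition W where "W t = interaction_parameter 1 \<sigma> (z1 t) (z2 t)"

lemma Im_z2: "\<sigma> * b t = Im (z2 t)"
  using \<sigma> by (auto simp: b_def)

lemma a_pos: "a t > 0" and b_sign: "\<sigma> * b t > 0"
  using motion \<sigma> by (auto simp: vortex_motion_def a_def b_def)

lemma b_nonzero: "b t \<noteq> 0"
  using b_sign[of t] by auto

lemma separation_pos: "S t > 0" "D t > 0"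
  using motion separations_pos[OF \<sigma>, of "z1 t" "z2 t"]
  by (auto simp: vortex_motion_def S_def D_def X_def a_def b_def)

lemma S_minus_D: "S t - D t = 4 * a t * b t"
  unfolding S_def D_def by (simp add: power2_eq_square algebra_simps)

lemma drift_a_eq:
  "drift (a t) (b t) (X t) = ((S t)\<^sup>2 - 8 * (a t + b t) * (a t)\<^sup>2 * b t) / (4 * pi * a t * S t * D t)"
  by (simp add: drift_def S_def D_def)

lemma drift_b_eq:
  "drift (b t) (a t) (X t) = ((S t)\<^sup>2 - 8 * (a t + b t) * (b t)\<^sup>2 * a t) / (4 * pi * b t * S t * D t)"
  by (simp add: drift_def S_def D_def add.commute power2_commute)

lemma climb_eq: "climb (a t) (b t) (X t) = 2 * X t * a t * b t / (pi * S t * D t)"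
  by (simp add: climb_def S_def D_def)

lemma velocity1: "velocity z1 t = Complex (drift (a t) (b t) (X t)) (climb (a t) (b t) (X t))"
  and velocity2: "velocity z2 t = Complex (drift (b t) (a t) (X t)) (- \<sigma> * climb (a t) (b t) (X t))"
  using motion by (auto simp: vortex_motion_iff[OF \<sigma>] a_def b_def X_def)

lemma has_derivative_z:
  "(z1 has_vector_derivative velocity z1 t) (at t)" "(z2 has_vector_derivative velocity z2 t) (at t)"
  using motion vector_derivative_works by (auto simp: vortex_motion_def velocity_def)

lemma DERIV_a: "(a has_real_derivative climb (a t) (b t) (X t)) (at t)"
  using has_field_derivative_Im[OF has_derivative_z(1)[of t]]
  by (simp add: velocity1 a_def[abs_def])

lemma DERIV_b: "(b has_real_derivative - climb (a t) (b t) (X t)) (at t)"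
proof -
  have "((\<lambda>t. \<sigma> * Im (z2 t)) has_real_derivative \<sigma> * Im (velocity z2 t)) (at t)"
    by (rule DERIV_cmult[OF has_field_derivative_Im[OF has_derivative_z(2)]])
  moreover have "\<sigma> * \<sigma> = 1" using \<sigma> by auto
  ultimately show ?thesis
    by (simp add: velocity2 b_def[abs_def] flip: mult.assoc)
qed

lemma DERIV_X: "(X has_real_derivative - (a t - b t) * S t / (4 * pi * a t * b t * D t)) (at t)"
proof -
  have "((\<lambda>t. Re (z1 t) - Re (z2 t)) has_real_derivative Re (velocity z1 t) - Re (velocity z2 t)) (at t)"
    by (intro DERIV_diff has_field_derivative_Re has_derivative_z)
  moreover have "drift (a t) (b t) (X t) - drift (b t) (a t) (X t)
      = - (a t - b t) * S t / (4 * pi * a t * b t * D t)"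
    unfolding S_def D_def using a_pos[of t] b_nonzero[of t] separation_pos[of t]
    by (intro drift_diff) (auto simp: S_def D_def)
  ultimately show ?thesis
    by (simp add: velocity1 velocity2 X_def[abs_def])
qed

text \<open>
  The first integrals are the momentum \<open>P = a + b\<close> and, equivalently to the Hamiltonian,
  \<open>K = 1 / (4 * a * b) - 1 / S\<close>.  They are defined by their values at time \<open>0\<close>.
\<close>

definition P where "P = a 0 + b 0"

lemma momentum: "a t + b t = P"
proof -
  have "((\<lambda>t. a t + b t) has_real_derivative 0) (at t)" for t
    using DERIV_add[OF DERIV_a DERIV_b] by simp
  then show ?thesis
    unfolding P_def by (intro DERIV_isconst_all) auto
qed

definition K where "K = 1 / (4 * a 0 * b 0) - 1 / S 0"

lemma energy: "1 / (4 * a t * b t) - 1 / S t = K"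
proof -
  have "((\<lambda>t. 1 / (4 * a t * b t) - 1 / S t) has_real_derivative 0) (at t)" for t
  proof -
    define v where "v = 2 * X t / (pi * S t * D t)"
    have nz: "a t \<noteq> 0" "b t \<noteq> 0" "S t \<noteq> 0" "D t \<noteq> 0"
      using a_pos[of t] b_nonzero[of t] separation_pos[of t] by auto
    have dS: "(S has_real_derivative 2 * X t * (- (a t - b t) * S t / (4 * pi * a t * b t * D t))) (at t)"
      unfolding S_def[abs_def] momentum
      by (auto intro!: derivative_eq_intros DERIV_X simp: S_def momentum)
    have dX: "2 * X t * (- (a t - b t) * S t / (4 * pi * a t * b t * D t))
        = - (a t - b t) * (S t)\<^sup>2 * v / (4 * a t * b t)"
      using nz unfolding v_def by (simp add: field_simps power2_eq_square)
    have da: "(a has_real_derivative v * (a t * b t)) (at t)"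
      and db: "(b has_real_derivative - v * (a t * b t)) (at t)"
      using DERIV_a[of t] DERIV_b[of t] by (simp_all add: climb_eq v_def mult_ac)
    define n where "n t = 4 * a t * b t" for t
    have n: "n t \<noteq> 0" using nz by (simp add: n_def)
    have dn: "(n has_real_derivative n t * (b t - a t) * v) (at t)"
      unfolding n_def[abs_def] by (auto intro!: derivative_eq_intros da db simp: algebra_simps)
    have dS': "(S has_real_derivative (b t - a t) * (S t)\<^sup>2 * v / n t) (at t)"
      using dS unfolding dX n_def by simp
    have "((\<lambda>t. 1 / n t - 1 / S t) has_real_derivative
        (b t - a t) * (S t)\<^sup>2 * v / n t / (S t)\<^sup>2 - n t * (b t - a t) * v / (n t)\<^sup>2) (at t)"
      using n nz by (auto intro!: derivative_eq_intros dn dS' simp: power2_eq_square)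
    moreover have "(b t - a t) * (S t)\<^sup>2 * v / n t / (S t)\<^sup>2 - n t * (b t - a t) * v / (n t)\<^sup>2 = 0"
      using n nz by (simp add: power2_eq_square)
    ultimately show ?thesis by (simp add: n_def)
  qed
  then show ?thesis
    unfolding K_def by (intro DERIV_isconst_all) auto
qed

lemma W_eq: "W t = \<sigma> * P\<^sup>2 * K"
proof -
  have nz: "a t \<noteq> 0" "b t \<noteq> 0" "S t \<noteq> 0" "D t \<noteq> 0"
    using a_pos[of t] b_nonzero[of t] separation_pos[of t] by auto
  have pos: "Im (z1 t) > 0" "Im (z2 t) > 0" "z1 t \<noteq> z2 t"
    using motion by (auto simp: vortex_motion_def)
  have "W t = P\<^sup>2 * (D t / (4 * a t * (\<sigma> * b t) * S t))"
    unfolding W_def interaction_parameter_def exp_vortex_hamiltonian[OF \<sigma> pos] vortex_momentum_def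
    using momentum[of t] by (simp add: Im_z2) (simp add: a_def b_def X_def S_def D_def)
  also have "D t / (4 * a t * (\<sigma> * b t) * S t) = \<sigma> * (1 / (4 * a t * b t) - 1 / S t)"
  proof -
    have "4 * a t * b t / (4 * a t * b t * S t) = 1 / S t" "S t / (4 * a t * b t * S t) = 1 / (4 * a t * b t)"
      using nz by auto
    moreover have "D t = S t - 4 * a t * b t" using S_minus_D[of t] by simp
    ultimately have "D t / (4 * a t * b t * S t) = 1 / (4 * a t * b t) - 1 / S t"
      by (simp only: diff_divide_distrib)
    then show ?thesis using \<sigma> by auto
  qed
  finally show ?thesis by (simp add: energy)
qed

end

section \<open>Growth, zeros and rotation\<close>

lemma DERIV_linear_growth:
  fixes f :: "real \<Rightarrow> real"
  assumes "s \<le> t" and "\<And>x. s \<le> x \<Longrightarrow> x \<le> t \<Longrightarrow> (f has_real_derivative f' x) (at x) \<and> c \<le> f' x"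
  shows "f s + c * (t - s) \<le> f t"
proof -
  have "f s - c * s \<le> f t - c * t"
  proof (rule DERIV_nonneg_imp_nondecreasing[OF assms(1)])
    fix x assume "s \<le> x" "x \<le> t"
    then have "((\<lambda>x. f x - c * x) has_real_derivative f' x - c) (at x)" and "0 \<le> f' x - c"
      using assms(2) by (auto intro!: derivative_eq_intros)
    then show "\<exists>y. ((\<lambda>x. f x - c * x) has_real_derivative y) (at x) \<and> 0 \<le> y" by blast
  qed
  then show ?thesis by (simp add: algebra_simps)
qed

lemma DERIV_growth_unbounded:
  fixes f :: "real \<Rightarrow> real"
  assumes "c > 0" and "\<And>x. s \<le> x \<Longrightarrow> (f has_real_derivative f' x) (at x) \<and> c \<le> f' x"
  obtains t where "s \<le> t" "f t > M"
proof -
  define t where "t = s + (\<bar>M - f s\<bar> + 1) / c"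
  have st: "s \<le> t" using assms(1) by (simp add: t_def)
  have "f s + c * (t - s) \<le> f t"
    using st assms(2) by (intro DERIV_linear_growth[where f' = f']) auto
  moreover have "c * (t - s) = \<bar>M - f s\<bar> + 1"
    using assms(1) by (simp add: t_def)
  ultimately have "f t > M" by linarith
  with st that show thesis by blast
qed

text \<open>
  A bounded motion in the plane that turns about the origin with both rates bounded away from
  zero keeps circling around it.  If \<open>X\<close> were eventually nonnegative, then \<open>s\<close> would increase.
  A positive value of \<open>s\<close> would drive \<open>X\<close> to minus infinity, so \<open>s \<le> 0\<close> and \<open>X\<close> increases; a
  positive value of \<open>X\<close> would drive \<open>s\<close> to infinity, so \<open>X\<close> vanishes from some time on,
  which contradicts its growth for \<open>s < 0\<close>.
\<close>

lemma planar_rotation_frequently_neg: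
  fixes X s A B :: "real \<Rightarrow> real"
  assumes X: "\<And>t. (X has_real_derivative - A t * s t) (at t)"
    and s: "\<And>t. (s has_real_derivative B t * X t) (at t)"
    and c: "c > 0" and A: "\<And>t. c \<le> A t" and B: "\<And>t. c \<le> B t"
    and bounded: "\<And>t. \<bar>X t\<bar> \<le> M" "\<And>t. \<bar>s t\<bar> \<le> M"
    and nonzero: "\<And>t. X t \<noteq> 0 \<or> s t \<noteq> 0"
  shows "\<exists>\<^sub>F t in at_top. X t < 0"
proof (rule ccontr)
  assume "\<not> ?thesis"
  then obtain T where T: "\<And>t. T \<le> t \<Longrightarrow> 0 \<le> X t"
    unfolding frequently_def eventually_at_top_linorder by (auto simp: not_less)
  have s_mono: "s u \<le> s t" if "T \<le> u" "u \<le> t" for u t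
  proof -
    have "s u + 0 * (t - u) \<le> s t"
      using that T B c s
      by (intro DERIV_linear_growth[where f' = "\<lambda>t. B t * X t"])
         (auto intro!: mult_nonneg_nonneg intro: order_trans[OF less_imp_le])
    then show ?thesis by simp
  qed
  have s_neg: "s u \<le> 0" if u: "T \<le> u" for u
  proof (rule ccontr)
    assume "\<not> s u \<le> 0"
    then have su: "0 < s u" by simp
    have "((\<lambda>x. - X x) has_real_derivative A t * s t) (at t) \<and> c * s u \<le> A t * s t"
      if "u \<le> t" for t
      using DERIV_minus[OF X[of t]] s_mono[OF u that] su A[of t] c by (auto intro!: mult_mono)
    with su c obtain t where "- X t > M"
      using DERIV_growth_unbounded[of "c * s u" u "\<lambda>x. - X x" "\<lambda>t. A t * s t" M] by auto
    with bounded(1)[of t] show False by linarith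
  qed
  have X_mono: "X u \<le> X t" if "T \<le> u" "u \<le> t" for u t
  proof -
    have "X u + 0 * (t - u) \<le> X t"
      using that s_neg A c X
      by (intro DERIV_linear_growth[where f' = "\<lambda>t. - A t * s t"])
         (auto intro!: mult_nonneg_nonpos intro: order_trans[OF less_imp_le])
    then show ?thesis by simp
  qed
  have X_zero: "X u = 0" if u: "T \<le> u" for u
  proof (rule ccontr)
    assume "X u \<noteq> 0"
    with T[OF u] have Xu: "0 < X u" by simp
    have "(s has_real_derivative B t * X t) (at t) \<and> c * X u \<le> B t * X t" if "u \<le> t" for t
      using s[of t] X_mono[OF u that] Xu B[of t] c by (auto intro!: mult_mono)
    with Xu c obtain t where "s t > M"
      using DERIV_growth_unbounded[of "c * X u" u s "\<lambda>t. B t * X t" M] by auto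
    with bounded(2)[of t] show False by linarith
  qed
  have "s T < 0" using s_neg[of T] X_zero[of T] nonzero[of T] by auto
  then have "- A T * s T > 0"
    using A[of T] c by (intro mult_neg_neg) auto
  from DERIV_pos_inc_right[OF X this] obtain d where d: "d > 0"
    "\<And>h. 0 < h \<Longrightarrow> h < d \<Longrightarrow> X T < X (T + h)" by blast
  with d(2)[of "d / 2"] X_zero[of T] X_zero[of "T + d / 2"] show False by simp
qed

lemma zero_with_nonpos_DERIV:
  fixes f :: "real \<Rightarrow> real"
  assumes "u < v" "f u > 0" "f v < 0" and f: "\<And>t. (f has_real_derivative f' t) (at t)"
  obtains t where "f t = 0" "f' t \<le> 0"
proof -
  have cont: "continuous_on A f" for A
    using f by (meson DERIV_isCont continuous_at_imp_continuous_on)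
  define Z where "Z = {t \<in> {u..v}. f t = 0}"
  have "\<exists>x. u \<le> x \<and> x \<le> v \<and> f x = 0"
    using assms cont by (intro IVT2') auto
  then have ne: "Z \<noteq> {}" by (auto simp: Z_def)
  have "closed Z" unfolding Z_def
    by (intro continuous_closed_preimage_constant cont) auto
  then have "compact Z"
    by (auto simp: compact_eq_bounded_closed Z_def intro: bounded_subset[OF bounded_closed_interval])
  then obtain t where t: "t \<in> Z" "\<And>x. x \<in> Z \<Longrightarrow> t \<le> x"
    using compact_attains_inf[OF _ ne] by blast
  have ft: "f t = 0" and ut: "u < t" "t \<le> v"
    using t(1) assms(2) by (auto simp: Z_def order.order_iff_strict)
  have pos: "f x > 0" if x: "u \<le> x" "x < t" for x
  proof (rule ccontr)
    assume "\<not> f x > 0"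
    then have "\<exists>y. u \<le> y \<and> y \<le> x \<and> f y = 0"
      using assms cont x by (intro IVT2') auto
    then obtain y where "u \<le> y" "y \<le> x" "f y = 0" by blast
    with t(2)[of y] x ut show False by (auto simp: Z_def)
  qed
  have "f' t \<le> 0"
  proof (rule ccontr)
    assume "\<not> f' t \<le> 0"
    then obtain d where d: "d > 0" "\<And>h. 0 < h \<Longrightarrow> h < d \<Longrightarrow> f (t - h) < f t"
      using DERIV_pos_inc_left[OF f, of t] by force
    define h where "h = min (d / 2) (t - u)"
    have "0 < h" "h < d" "u \<le> t - h" using d ut by (auto simp: h_def min_def)
    with d(2)[of h] pos[of "t - h"] ft show False by simp
  qed
  with ft that show thesis by blast
qed

section \<open>Signs of the horizontal velocities\<close>

context mirror_motion
begin

text \<open>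
  The numerators of the two drifts.  Up to positive factors, and for the second vortex the factor
  \<open>\<sigma>\<close>, they are the horizontal velocities.
\<close>

definition Q1 where "Q1 t = (S t)\<^sup>2 - 8 * P * (a t)\<^sup>2 * b t"
definition Q2 where "Q2 t = (S t)\<^sup>2 - 8 * P * (b t)\<^sup>2 * a t"

lemma S_eq: "S t = (X t)\<^sup>2 + P\<^sup>2"
  by (simp add: S_def momentum)

lemma sgn_velocity1: "sgn (Re (velocity z1 t)) = sgn (Q1 t)"
proof -
  have "Re (velocity z1 t) = Q1 t / (4 * pi * a t * S t * D t)"
    by (simp add: velocity1 drift_a_eq Q1_def momentum)
  moreover have "sgn (4 * pi * a t * S t * D t) = 1"
    using a_pos[of t] separation_pos[of t] by simp
  ultimately show ?thesis by (simp only: sgn_divide)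
qed

lemma sgn_velocity2: "sgn (Re (velocity z2 t)) = \<sigma> * sgn (Q2 t)"
proof -
  have "Re (velocity z2 t) = Q2 t / (4 * pi * b t * S t * D t)"
    by (simp add: velocity2 drift_b_eq Q2_def momentum)
  moreover have "sgn (b t) = \<sigma>"
    using b_sign[of t] \<sigma> by auto
  then have "sgn (4 * pi * b t * S t * D t) = \<sigma>"
    using separation_pos[of t] by (simp add: sgn_mult)
  ultimately show ?thesis using \<sigma> by (auto simp: sgn_divide)
qed

lemma velocity_zero_imp:
  "velocity z1 t = 0 \<Longrightarrow> X t = 0 \<and> Q1 t = 0"
  "velocity z2 t = 0 \<Longrightarrow> X t = 0 \<and> Q2 t = 0"
proof -
  have "X t = 0" if "climb (a t) (b t) (X t) = 0"
    using that a_pos[of t] b_nonzero[of t] separation_pos[of t] by (simp add: climb_eq)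
  moreover assume "velocity z1 t = 0"
  ultimately show "X t = 0 \<and> Q1 t = 0"
    using sgn_velocity1[of t] by (auto simp: velocity1 complex_eq_iff sgn_0_0)
next
  have "X t = 0" if "climb (a t) (b t) (X t) = 0"
    using that a_pos[of t] b_nonzero[of t] separation_pos[of t] by (simp add: climb_eq)
  moreover assume "velocity z2 t = 0"
  ultimately show "X t = 0 \<and> Q2 t = 0"
    using sgn_velocity2[of t] \<sigma> by (auto simp: velocity2 complex_eq_iff sgn_0_0)
qed

lemma velocity_zeroI:
  "X t = 0 \<Longrightarrow> Q1 t = 0 \<Longrightarrow> velocity z1 t = 0"
  "X t = 0 \<Longrightarrow> Q2 t = 0 \<Longrightarrow> velocity z2 t = 0"
proof -
  assume "X t = 0"
  then have c: "climb (a t) (b t) (X t) = 0" unfolding climb_eq by simp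
  show "velocity z1 t = 0" if "Q1 t = 0"
    using sgn_velocity1[of t] that by (simp add: velocity1 c complex_eq_iff sgn_0_0)
  show "velocity z2 t = 0" if "Q2 t = 0"
    using sgn_velocity2[of t] that by (simp add: velocity2 c complex_eq_iff sgn_0_0)
qed

text \<open>
  When the two vortices are on one vertical, then \<open>S = P\<^sup>2\<close> and the numerators factor.  The factor
  \<open>a - b\<close> does not vanish, since the vortices do not collide.
\<close>

lemma on_vertical:
  assumes "X t = 0"
  shows "Q1 t = P * (a t - b t) * ((a t)\<^sup>2 - 4 * a t * b t - (b t)\<^sup>2)"
    and "Q2 t = P * (b t - a t) * ((b t)\<^sup>2 - 4 * a t * b t - (a t)\<^sup>2)"
    and "W t = \<sigma> * (a t - b t)\<^sup>2 / (4 * a t * b t)"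
    and "P \<noteq> 0" "a t \<noteq> b t"
proof -
  have S: "S t = P\<^sup>2" using assms by (simp add: S_eq)
  show P: "P \<noteq> 0" using separation_pos(1)[of t] S by auto
  show "a t \<noteq> b t" using separation_pos(2)[of t] assms by (auto simp: D_def)
  show "Q1 t = P * (a t - b t) * ((a t)\<^sup>2 - 4 * a t * b t - (b t)\<^sup>2)"
    and "Q2 t = P * (b t - a t) * ((b t)\<^sup>2 - 4 * a t * b t - (a t)\<^sup>2)"
    unfolding Q1_def Q2_def S momentum[of t, symmetric]
    by (simp_all add: power2_eq_square algebra_simps)
  have "W t = \<sigma> * (P\<^sup>2 * (1 / (4 * a t * b t) - 1 / P\<^sup>2))"
    using W_eq[of t] energy[of t] by (simp add: S)
  also have "P\<^sup>2 * (1 / (4 * a t * b t) - 1 / P\<^sup>2) = (P\<^sup>2 - 4 * a t * b t) / (4 * a t * b t)"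
    using P a_pos[of t] b_nonzero[of t] by (simp add: field_simps)
  also have "P\<^sup>2 - 4 * a t * b t = (a t - b t)\<^sup>2"
    unfolding momentum[of t, symmetric] by (simp add: power2_eq_square algebra_simps)
  finally show "W t = \<sigma> * (a t - b t)\<^sup>2 / (4 * a t * b t)" by simp
qed

section \<open>The vortex pair\<close>

lemma pair_W:
  assumes "\<sigma> = 1"
  shows "W t = P\<^sup>2 * K"
  using assms by (subst W_eq) simp

lemma pair_Im_z2:
  assumes "\<sigma> = 1"
  shows "Im (z2 t) = b t"
  using Im_z2[of t] assms by (metis mult_1)

lemma pair_pos:
  assumes "\<sigma> = 1"
  shows "b t > 0" "a t > 0" "4 * a t * b t < S t" "4 * a t * b t \<le> P\<^sup>2" "P\<^sup>2 \<le> S t"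
proof -
  show b: "b t > 0" using b_sign[of t] assms by simp
  show "a t > 0" by (rule a_pos)
  show "4 * a t * b t < S t" using S_minus_D[of t] separation_pos(2)[of t] by linarith
  have "P\<^sup>2 - 4 * a t * b t = (a t - b t)\<^sup>2"
    unfolding momentum[of t, symmetric] by (simp add: power2_eq_square algebra_simps)
  then show "4 * a t * b t \<le> P\<^sup>2" using zero_le_power2[of "a t - b t"] by linarith
  show "P\<^sup>2 \<le> S t" by (simp add: S_eq)
qed

lemma pair_P_pos:
  assumes "\<sigma> = 1"
  shows "P > 0"
  unfolding P_def using pair_pos(1,2)[OF assms, of 0] by linarith

text \<open>
  A weakly interacting pair never moves backwards.  Since \<open>P\<^sup>2 \<le> S\<close>, the bound \<open>1 / \<phi> \<le> W\<close> gives
  \<open>S / (4 * a * b) \<ge> 1 + 1 / \<phi> = \<phi>\<close>.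
\<close>

lemma pair_velocity_nonneg:
  assumes \<sigma>1: "\<sigma> = 1" and w: "1 / golden_ratio \<le> W t"
  shows "Q1 t \<ge> 0" "Q2 t \<ge> 0" "1 / golden_ratio < W t \<Longrightarrow> Q1 t > 0 \<and> Q2 t > 0"
proof -
  define n where "n = 4 * a t * b t"
  note pos = pair_pos[OF \<sigma>1, of t]
  have n: "n > 0" "n < S t" using pos a_pos[of t] by (auto simp: n_def)
  have "W t = P\<^sup>2 * (1 / n - 1 / S t)"
    using pair_W[OF \<sigma>1, of t] energy[of t] by (simp add: n_def)
  also have "\<dots> \<le> S t * (1 / n - 1 / S t)"
  proof (rule mult_right_mono[OF pos(5)])
    show "0 \<le> 1 / n - 1 / S t" using frac_le[of 1 1 n "S t"] n by linarith
  qed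
  also have "\<dots> = S t / n - 1" using n by (simp add: right_diff_distrib)
  finally have Wn: "W t + 1 \<le> S t / n" by simp
  then have le: "golden_ratio * n \<le> S t"
    using w n unfolding inverse_golden_ratio pos_le_divide_eq[OF n(1)]
    using mult_right_mono[of golden_ratio "W t + 1" n] by linarith
  have lt: "golden_ratio * n < S t" if "1 / golden_ratio < W t"
    using Wn that n unfolding inverse_golden_ratio pos_le_divide_eq[OF n(1)]
    using mult_strict_right_mono[of golden_ratio "W t + 1" n] by linarith
  have R: "(a t + b t)\<^sup>2 \<le> S t" "(b t + a t)\<^sup>2 \<le> S t"
    using pos(5) momentum[of t] by (auto simp: add.commute)
  note bound1 = pair_drift_bound[OF a_pos[of t] pos(1) R(1)]
  note bound2 = pair_drift_bound[OF pos(1) a_pos[of t] R(2)]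
  have sum: "b t + a t = P" using momentum[of t] by simp
  have n': "4 * a t * b t = n" "4 * b t * a t = n" by (auto simp: n_def)
  show "Q1 t \<ge> 0"
    using bound1(1) le unfolding n' momentum Q1_def by linarith
  show "Q2 t \<ge> 0"
    using bound2(1) le unfolding n' sum Q2_def by linarith
  assume "1 / golden_ratio < W t"
  from bound1(2) bound2(2) le lt[OF this] show "Q1 t > 0 \<and> Q2 t > 0"
    unfolding n' momentum sum Q1_def Q2_def by linarith
qed

lemma pair_W_less_1:
  assumes "\<sigma> = 1" "a t = b t"
  shows "W t < 1"
proof -
  have n: "4 * a t * b t = P\<^sup>2"
    unfolding momentum[of t, symmetric] using assms(2) by (simp add: power2_eq_square)
  have "W t = P\<^sup>2 * (1 / P\<^sup>2 - 1 / S t)"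
    using pair_W[OF assms(1), of t] energy[of t] unfolding n by simp
  also have "\<dots> = 1 - P\<^sup>2 / S t"
    using pair_P_pos[OF assms(1)] by (simp add: right_diff_distrib)
  also have "\<dots> < 1" using pair_P_pos[OF assms(1)] separation_pos(1)[of t] by simp
  finally show ?thesis .
qed

lemma continuous_heights: "continuous_on T a" "continuous_on T b" "continuous_on T X"
  using DERIV_a DERIV_b DERIV_X by (meson DERIV_isCont continuous_at_imp_continuous_on)+

lemma pair_alternate_imp_W_less_1:
  assumes \<sigma>1: "\<sigma> = 1" and alt: "vortices_alternate z1 z2"
  shows "W t < 1"
proof -
  have h: "Im (z1 t) = a t" "Im (z2 t) = b t" for t
    by (rule a_def[symmetric], rule pair_Im_z2[OF \<sigma>1])
  have "\<exists>\<^sub>F t in at_top. a t < b t" and "\<exists>\<^sub>F t in at_top. b t < a t"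
    using alt unfolding vortices_alternate_def h by simp_all
  then obtain u v where u: "a u < b u" and v: "b v < a v"
    by (meson frequently_ex)
  have "connected (range (\<lambda>t. a t - b t))"
    by (intro connected_continuous_image continuous_on_diff continuous_heights connected_UNIV)
  then have "0 \<in> range (\<lambda>t. a t - b t)"
    by (rule connectedD_interval[of _ "a u - b u" "a v - b v"]) (use u v in simp_all)
  then obtain r where "a r = b r" by auto
  from pair_W_less_1[OF \<sigma>1 this] show ?thesis by (simp only: W_eq)
qed

text \<open>
  For \<open>W < 1\<close> the level curve of the energy in the plane of \<open>X\<close> and \<open>s = a - b\<close> is a closed curve
  around the collision point, and the motion runs around it for ever.  In particular it
  crosses \<open>X = 0\<close> with either vortex on top.
\<close>

lemma pair_alternate:
  assumes \<sigma>1: "\<sigma> = 1" and w: "W 0 < 1"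
  shows "vortices_alternate z1 z2"
    and "\<exists>t. X t = 0 \<and> b t < a t" "\<exists>t. X t = 0 \<and> a t < b t"
proof -
  define w where "w = W 0"
  define s where "s t = a t - b t" for t
  define A where "A t = S t / (4 * pi * a t * b t * D t)" for t
  define B where "B t = 4 * a t * b t / (pi * S t * D t)" for t
  define M where "M = P\<^sup>2 / (1 - w)"
  have P: "P > 0" using pair_P_pos[OF \<sigma>1] .
  have w1: "w < 1" using w by (simp add: w_def)
  have K: "K = w / P\<^sup>2" using P pair_W[OF \<sigma>1, of 0] by (simp add: w_def)
  have nonzero: "X t \<noteq> 0 \<or> s t \<noteq> 0" for t
    using separation_pos(2)[of t] by (auto simp: D_def s_def)
  have dX: "(X has_real_derivative - A t * s t) (at t)" for t
    by (rule DERIV_cong[OF DERIV_X]) (simp add: A_def s_def algebra_simps diff_divide_distrib)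
  have ds: "(s has_real_derivative B t * X t) (at t)" for t
    using DERIV_diff[OF DERIV_a DERIV_b, of t] by (simp add: s_def[abs_def] B_def climb_eq mult_ac)
  have n: "0 < 4 * a t * b t" for t using pair_pos(1)[OF \<sigma>1] a_pos by simp
  have w0: "0 < w"
  proof -
    have "1 / S 0 < 1 / (4 * a 0 * b 0)"
      using n[of 0] pair_pos(3)[OF \<sigma>1, of 0] by (intro divide_strict_left_mono) auto
    then have "K > 0" using energy[of 0] by simp
    then show ?thesis using pair_W[OF \<sigma>1, of 0] P by (simp add: w_def)
  qed
  have M0: "0 < M" using P w1 by (simp add: M_def)
  have SM: "S t \<le> M" for t
  proof -
    have "1 / P\<^sup>2 \<le> 1 / (4 * a t * b t)"
      using n[of t] P pair_pos(4)[OF \<sigma>1, of t] by (intro divide_left_mono) auto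
    then have "1 / P\<^sup>2 - K \<le> 1 / S t" using energy[of t] by linarith
    then have "1 / M \<le> 1 / S t" by (simp add: K M_def diff_divide_distrib)
    then show ?thesis using le_imp_inverse_le[of "1 / M" "1 / S t"] M0 by simp
  qed
  have n_ge: "P\<^sup>2 / (1 + w) \<le> 4 * a t * b t" for t
  proof -
    have "1 / S t \<le> 1 / P\<^sup>2"
      using pair_pos(5)[OF \<sigma>1, of t] P separation_pos(1)[of t] by (intro divide_left_mono) auto
    then have "1 / (4 * a t * b t) \<le> (1 + w) / P\<^sup>2"
      using energy[of t] by (simp add: K add_divide_distrib)
    then show ?thesis
      using le_imp_inverse_le[of "1 / (4 * a t * b t)" "(1 + w) / P\<^sup>2"] n[of t] by simp
  qed
  have DS: "D t \<le> S t" for t using S_minus_D[of t] n[of t] by linarith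
  define c where "c = min (1 / (pi * P\<^sup>2)) (P\<^sup>2 / (1 + w) / (pi * M * M))"
  have c: "c > 0" using P w0 M0 by (simp add: c_def)
  have A: "c \<le> A t" for t
  proof -
    have "c \<le> 1 / (pi * P\<^sup>2)" by (simp add: c_def)
    also have "\<dots> \<le> 1 / (pi * (4 * a t * b t))"
      using n[of t] P pair_pos(4)[OF \<sigma>1, of t] by (intro divide_left_mono) auto
    also have "\<dots> = D t / (pi * (4 * a t * b t) * D t)" using separation_pos[of t] by simp
    also have "\<dots> \<le> S t / (pi * (4 * a t * b t) * D t)"
      using n[of t] separation_pos[of t] DS[of t] by (intro divide_right_mono) auto
    finally show ?thesis by (simp add: A_def mult_ac)
  qed
  have B: "c \<le> B t" for t
  proof -
    have "c \<le> P\<^sup>2 / (1 + w) / (pi * M * M)" by (simp add: c_def)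
    also have "\<dots> \<le> 4 * a t * b t / (pi * S t * D t)"
      using n_ge[of t] SM[of t] DS[of t] n[of t] separation_pos[of t] M0
      by (intro frac_le mult_mono) auto
    finally show ?thesis by (simp add: B_def)
  qed
  have bX: "\<bar>X t\<bar> \<le> max (sqrt M) P" for t
  proof -
    have "(X t)\<^sup>2 \<le> M" using SM[of t] zero_le_power2[of P] unfolding S_eq by linarith
    then show ?thesis using real_sqrt_le_mono[of "(X t)\<^sup>2" M] by simp
  qed
  have bs: "\<bar>s t\<bar> \<le> max (sqrt M) P" for t
    using a_pos[of t] pair_pos(1)[OF \<sigma>1, of t] momentum[of t] unfolding s_def by linarith
  \<comment> \<open>A quarter turn and a half turn of the plane preserve the form of the system.\<close>
  have X_neg: "\<exists>\<^sub>F t in at_top. X t < 0"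
    using dX ds c A B bX bs nonzero by (rule planar_rotation_frequently_neg)
  have nX: "((\<lambda>t. - X t) has_real_derivative A t * s t) (at t)" for t
    by (rule DERIV_cong[OF DERIV_minus[OF dX]]) simp
  have ns: "((\<lambda>t. - s t) has_real_derivative - (B t * X t)) (at t)" for t
    by (rule DERIV_minus[OF ds])
  have nonzero': "s t \<noteq> 0 \<or> X t \<noteq> 0" for t using nonzero[of t] by blast
  note facts = dX ds nX ns c A B bX bs nonzero nonzero'
  have X_pos: "\<exists>\<^sub>F t in at_top. - X t < 0"
    by (rule planar_rotation_frequently_neg[of "\<lambda>t. - X t" A "\<lambda>t. - s t" B c "max (sqrt M) P"])
       (simp_all only: facts abs_minus_cancel minus_mult_minus neg_equal_0_iff_equal
          mult_minus_right mult_minus_left minus_minus)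
  have s_neg: "\<exists>\<^sub>F t in at_top. s t < 0"
    by (rule planar_rotation_frequently_neg[of s B "\<lambda>t. - X t" A c "max (sqrt M) P"])
       (simp_all only: facts abs_minus_cancel minus_mult_minus neg_equal_0_iff_equal)
  have s_pos: "\<exists>\<^sub>F t in at_top. - s t < 0"
    by (rule planar_rotation_frequently_neg[of "\<lambda>t. - s t" B X A c "max (sqrt M) P"])
       (simp_all only: facts abs_minus_cancel mult_minus_left mult_minus_right
          neg_equal_0_iff_equal dX[unfolded mult_minus_left])
  show "vortices_alternate z1 z2"
    using X_neg X_pos s_neg s_pos
    by (simp add: vortices_alternate_def X_def s_def a_def pair_Im_z2[OF \<sigma>1])
  have freq: "\<exists>t>u. R t" if "\<exists>\<^sub>F t in at_top. R t" for R and u :: real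
    using frequently_ex[OF frequently_eventually_frequently[OF that eventually_gt_at_top[of u]]] by blast
  obtain p where p: "X p > 0" using freq[OF X_pos] by auto
  obtain q where q: "q > p" "X q < 0" using freq[OF X_neg] by blast
  obtain r where r: "r > q" "X r > 0" using freq[OF X_pos] by auto
  \<comment> \<open>A zero of \<open>X\<close> that is reached from above has \<open>s > 0\<close>, as \<open>X' = - A * s \<le> 0\<close> there.\<close>
  obtain t where t: "X t = 0" "- A t * s t \<le> 0"
    using zero_with_nonpos_DERIV[OF q(1) p q(2) dX] by blast
  have At: "A t > 0" for t using A[of t] c by linarith
  have "0 \<le> s t" using t(2) At[of t] by (simp add: zero_le_mult_iff)
  then show "\<exists>t. X t = 0 \<and> b t < a t"
    using t(1) nonzero[of t] by (intro exI[of _ t]) (auto simp: s_def)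
  obtain u where u: "- X u = 0" "- (- A u * s u) \<le> 0"
  proof (rule zero_with_nonpos_DERIV[OF r(1) _ _ nX])
    show "- X q > 0" "- X r < 0" using q(2) r(2) by auto
  qed auto
  have "s u \<le> 0" using u(2) At[of u] by (simp add: mult_le_0_iff)
  then show "\<exists>t. X t = 0 \<and> a t < b t"
    using u(1) nonzero[of u] by (intro exI[of _ u]) (auto simp: s_def)
qed

text \<open>
  On a common vertical the upper vortex of a pair moves forwards or backwards according to the
  position of \<open>W\<close> relative to \<open>1 / \<phi>\<close>, while the lower one always moves forwards.
\<close>

lemma pair_sgn_on_vertical:
  assumes \<sigma>1: "\<sigma> = 1" and X: "X t = 0"
  shows "b t < a t \<Longrightarrow> sgn (Q1 t) = sgn (W t - 1 / golden_ratio)" "b t < a t \<Longrightarrow> Q2 t > 0"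
    "a t < b t \<Longrightarrow> sgn (Q2 t) = sgn (W t - 1 / golden_ratio)" "a t < b t \<Longrightarrow> Q1 t > 0"
proof -
  have pos: "a t > 0" "b t > 0" "P > 0" using pair_pos[OF \<sigma>1] pair_P_pos[OF \<sigma>1] by auto
  note v = on_vertical[OF X]
  have W: "W t = (a t - b t)\<^sup>2 / (4 * a t * b t)" "W t = (b t - a t)\<^sup>2 / (4 * b t * a t)"
    using v(3) \<sigma>1 by (auto simp: power2_commute mult_ac)
  have other: "q\<^sup>2 - 4 * p * q - p\<^sup>2 < 0" if "0 < q" "q < p" for p q :: real
  proof -
    have "q\<^sup>2 \<le> p\<^sup>2" using that by (intro power_mono) auto
    moreover have "p * q > 0" using that by simp
    ultimately show ?thesis by (simp add: algebra_simps)
  qed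
  show "sgn (Q1 t) = sgn (W t - 1 / golden_ratio)" if "b t < a t"
  proof -
    have "sgn (Q1 t) = sgn ((a t)\<^sup>2 - 4 * a t * b t - (b t)\<^sup>2)"
      using pos that by (simp add: v(1) sgn_mult)
    also have "\<dots> = sgn (W t - 1 / golden_ratio)"
      using cusp_ratio[OF that pos(2)] unfolding W(1) inverse_golden_ratio by (intro sgn_eqI) auto
    finally show ?thesis .
  qed
  show "sgn (Q2 t) = sgn (W t - 1 / golden_ratio)" if "a t < b t"
  proof -
    have "sgn (Q2 t) = sgn ((b t)\<^sup>2 - 4 * b t * a t - (a t)\<^sup>2)"
      using pos that by (simp add: v(2) sgn_mult mult_ac)
    also have "\<dots> = sgn (W t - 1 / golden_ratio)"
      using cusp_ratio[OF that pos(1)] unfolding W(2) inverse_golden_ratio by (intro sgn_eqI) auto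
    finally show ?thesis .
  qed
  show "Q2 t > 0" if "b t < a t"
    unfolding v(2) using that pos other[of "b t" "a t"] by (intro mult_neg_neg mult_pos_neg) auto
  show "Q1 t > 0" if "a t < b t"
    unfolding v(1) using that pos other[of "a t" "b t"]
    by (intro mult_neg_neg mult_pos_neg) (auto simp: mult_ac)
qed


section \<open>The dipole\<close>

text \<open>
  For a dipole the true height of the second vortex is \<open>- b\<close>, and \<open>- 4 * a * b\<close> is positive.
\<close>

lemma dipole_facts:
  assumes "\<sigma> = - 1"
  shows "b t < 0" "0 < - (4 * a t * b t)" "P\<^sup>2 \<le> S t"
    and "W t = P\<^sup>2 * (1 / (- (4 * a t * b t)) + 1 / S t)"
proof -
  show b: "b t < 0" using b_sign[of t] assms by simp
  then show "0 < - (4 * a t * b t)" using a_pos[of t] by (simp add: mult_pos_neg)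
  show "P\<^sup>2 \<le> S t" by (simp add: S_eq)
  have "W t = - (P\<^sup>2 * K)" using assms by (subst W_eq) simp
  then show "W t = P\<^sup>2 * (1 / (- (4 * a t * b t)) + 1 / S t)"
    unfolding energy[of t, symmetric] by (simp add: algebra_simps)
qed

lemma dipole_W_gt_1:
  assumes \<sigma>1: "\<sigma> = - 1" and X: "X t = 0"
  shows "W t = 1 + (a t + b t)\<^sup>2 / (4 * a t * (- b t))" "W t > 1"
proof -
  have n: "0 < 4 * a t * (- b t)" using dipole_facts(2)[OF \<sigma>1, of t] by simp
  have S: "S t = P\<^sup>2" and P: "P \<noteq> 0" using on_vertical(4)[OF X] X by (auto simp: S_eq)
  have "W t = P\<^sup>2 * (1 / (4 * a t * (- b t)) + 1 / P\<^sup>2)"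
    using dipole_facts(4)[OF \<sigma>1, of t] unfolding S by simp
  also have "\<dots> = 1 + P\<^sup>2 / (4 * a t * (- b t))"
    using P by (simp add: right_diff_distrib)
  finally show eq: "W t = 1 + (a t + b t)\<^sup>2 / (4 * a t * (- b t))"
    by (simp only: momentum)
  have "0 < (a t + b t)\<^sup>2 / (4 * a t * (- b t))"
    using n P by (intro divide_pos_pos) (simp_all only: momentum zero_less_power2 not_False_eq_True)
  then show "W t > 1" unfolding eq by linarith
qed

lemma vortices_pass_imp_zero:
  assumes "vortices_pass z1 z2"
  obtains t where "X t = 0"
proof -
  have X: "(\<lambda>t. Re (z1 t) - Re (z2 t)) = X" by (simp add: X_def[abs_def])
  have "\<exists>u v. X u < 0 \<and> 0 < X v"
  proof -
    have ex: "\<exists>t. R t" if "eventually R F" "F \<noteq> bot" for R and F :: "real filter"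
      using eventually_happens'[OF that(2,1)] .
    from assms show ?thesis
      unfolding vortices_pass_def X filterlim_at_top_dense filterlim_at_bot_dense
      by (elim disjE conjE) (blast dest: ex[OF _ trivial_limit_at_bot_linorder]
          ex[OF _ trivial_limit_at_top_linorder] spec[of _ 0])+
  qed
  then obtain u v where uv: "X u < 0" "0 < X v" by blast
  have "connected (range X)"
    by (intro connected_continuous_image continuous_heights connected_UNIV)
  then have "0 \<in> range X"
    by (rule connectedD_interval[of _ "X u" "X v"]) (use uv in simp_all)
  then obtain r where "X r = 0" by auto
  then show thesis by (rule that)
qed

text \<open>
  For \<open>W > 1\<close> the horizontal distance of a dipole grows at a rate bounded below by a positive
  constant, since the level relation keeps \<open>- 4 * a * b\<close> below \<open>P\<^sup>2 / (W - 1)\<close>.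
\<close>

lemma dipole_pass:
  assumes \<sigma>1: "\<sigma> = - 1" and w: "W 0 > 1"
  shows "vortices_pass z1 z2" "\<exists>t. 2 * P\<^sup>2 \<le> S t"
proof -
  define w where "w = W 0"
  define n where "n t = - (4 * a t * b t)" for t
  define M where "M = P\<^sup>2 / (w - 1)"
  have w1: "w > 1" using w by (simp add: w_def)
  have w_eq: "w = P\<^sup>2 * (1 / n t + 1 / S t)" for t
    using dipole_facts(4)[OF \<sigma>1, of t] by (simp only: w_def n_def W_eq)
  have P: "P \<noteq> 0" using w_eq[of 0] w1 by auto
  have n: "n t > 0" for t using dipole_facts(2)[OF \<sigma>1] by (simp add: n_def)
  have M0: "M > 0" using P w1 by (simp add: M_def)
  have nM: "n t \<le> M" for t
  proof -
    have "P\<^sup>2 / S t \<le> 1" using dipole_facts(3)[OF \<sigma>1, of t] separation_pos(1)[of t] by simp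
    then have "w - 1 \<le> P\<^sup>2 / n t" using w_eq[of t] by (simp add: distrib_left)
    then show ?thesis using n[of t] w1 by (simp add: M_def field_simps)
  qed
  define c where "c = \<bar>P\<bar> * P\<^sup>2 / (pi * M * (P\<^sup>2 + M))"
  have c: "c > 0" using P M0 by (simp add: c_def add_pos_pos)
  define X' where "X' t = - (a t - b t) * S t / (4 * pi * a t * b t * D t)" for t
  have dX: "(X has_real_derivative X' t) (at t)" for t
    using DERIV_X[of t] by (simp only: X'_def)
  have X': "c \<le> X' t" for t
  proof -
    have D: "D t = S t + n t" using S_minus_D[of t] by (simp add: n_def)
    have S: "0 < S t" "P\<^sup>2 \<le> S t" using separation_pos dipole_facts(3)[OF \<sigma>1] by auto
    have absP: "\<bar>P\<bar> \<le> a t - b t"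
      using momentum[of t] a_pos[of t] dipole_facts(1)[OF \<sigma>1, of t] by linarith
    have "P\<^sup>2 / (P\<^sup>2 + M) \<le> S t / (S t + n t)"
    proof -
      have "P\<^sup>2 * n t \<le> S t * M" using S nM[of t] n[of t] by (intro mult_mono) auto
      then have "P\<^sup>2 * (S t + n t) \<le> S t * (P\<^sup>2 + M)" by (simp add: algebra_simps)
      moreover have "0 < P\<^sup>2 + M" "0 < S t + n t"
        using M0 n[of t] S by (auto intro: add_nonneg_pos)
      ultimately show ?thesis by (simp add: pos_divide_le_eq pos_le_divide_eq mult.commute)
    qed
    moreover have "\<bar>P\<bar> / (pi * M) \<le> (a t - b t) / (pi * n t)"
      using absP nM[of t] n[of t] by (intro frac_le mult_left_mono) auto
    ultimately have "\<bar>P\<bar> / (pi * M) * (P\<^sup>2 / (P\<^sup>2 + M)) \<le> (a t - b t) / (pi * n t) * (S t / (S t + n t))"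
      using absP n[of t] M0 S by (intro mult_mono divide_nonneg_nonneg) auto
    also have "(a t - b t) / (pi * n t) * (S t / (S t + n t)) = X' t"
    proof -
      have "4 * pi * a t * b t * D t = - (pi * n t * D t)" by (simp add: n_def)
      then have "X' t = (a t - b t) * S t / (pi * n t * D t)"
        unfolding X'_def by (simp only: mult_minus_left minus_divide_divide)
      then show ?thesis by (simp add: D)
    qed
    finally show ?thesis by (simp add: c_def)
  qed
  have up: "X 0 + c * t \<le> X t" if "0 \<le> t" for t
    using DERIV_linear_growth[of 0 t X X' c] that dX X' by simp
  have down: "X t \<le> X 0 + c * t" if "t \<le> 0" for t
    using DERIV_linear_growth[of t 0 X X' c] that dX X' by simp
  have top: "filterlim (\<lambda>t. X 0 + c * t) at_top at_top"
    by (intro filterlim_tendsto_add_at_top[OF tendsto_const]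
        filterlim_tendsto_pos_mult_at_top[OF tendsto_const c] filterlim_ident)
  have X_top: "filterlim X at_top at_top"
    by (rule filterlim_at_top_mono[OF top]) (use up in \<open>auto simp: eventually_at_top_linorder\<close>)
  have X_bot: "filterlim X at_bot at_bot"
    unfolding filterlim_at_bot eventually_at_bot_linorder
  proof (intro allI exI impI)
    fix Z t assume t: "t \<le> min 0 ((Z - X 0) / c)"
    then have "c * t \<le> Z - X 0" using c by (simp add: pos_le_divide_eq mult.commute)
    with down[of t] t show "X t \<le> Z" by simp
  qed
  show "vortices_pass z1 z2"
    using X_top X_bot by (simp add: vortices_pass_def X_def[abs_def])
  obtain t where "\<bar>P\<bar> \<le> X t"
    using X_top eventually_happens'[OF trivial_limit_at_top_linorder]
    unfolding filterlim_at_top by blast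
  then have "P\<^sup>2 \<le> (X t)\<^sup>2"
    using power_mono[of "\<bar>P\<bar>" "X t" 2] by simp
  then show "\<exists>t. 2 * P\<^sup>2 \<le> S t"
    by (intro exI[of _ t]) (simp add: S_eq)
qed

text \<open>
  The momentum \<open>P\<close> is the difference of the true heights, so its sign tells which vortex is
  farther from the boundary.  That vortex never turns back.
\<close>

lemma dipole_outer_positive:
  assumes \<sigma>1: "\<sigma> = - 1"
  shows "P > 0 \<Longrightarrow> Q1 t > 0" "P < 0 \<Longrightarrow> Q2 t > 0"
proof -
  have "0 < (S t)\<^sup>2" using separation_pos(1)[of t] by simp
  moreover have "8 * P * (a t)\<^sup>2 * b t < 0" if "P > 0"
    using that a_pos[of t] dipole_facts(1)[OF \<sigma>1, of t] by (intro mult_pos_neg) auto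
  moreover have "8 * P * (b t)\<^sup>2 * a t < 0" if "P < 0"
    using that a_pos[of t] b_nonzero[of t]
      mult_neg_pos[OF mult_neg_pos[of "8 * P" "(b t)\<^sup>2"], of "a t"] by simp
  ultimately show "P > 0 \<Longrightarrow> Q1 t > 0" "P < 0 \<Longrightarrow> Q2 t > 0"
    unfolding Q1_def Q2_def by linarith+
qed

lemma dipole_velocity_bound:
  assumes \<sigma>1: "\<sigma> = - 1"
  shows "4 * a t * (- b t) \<le> golden_ratio * S t \<Longrightarrow> Q1 t \<ge> 0 \<and> Q2 t \<ge> 0"
    and "4 * a t * (- b t) < golden_ratio * S t \<Longrightarrow> Q1 t > 0 \<and> Q2 t > 0"
proof -
  have pos: "a t > 0" "- b t > 0" using a_pos dipole_facts(1)[OF \<sigma>1, of t] by auto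
  have R: "(a t - - b t)\<^sup>2 \<le> S t" "(- b t - a t)\<^sup>2 \<le> S t"
    using dipole_facts(3)[OF \<sigma>1, of t] power2_commute[of "- b t" "a t"]
    by (simp_all add: momentum)
  have P: "a t - - b t = P" "- b t - a t = - P" using momentum[of t] by auto
  have Q: "Q1 t = (S t)\<^sup>2 - 8 * (- b t - a t) * (- b t) * (a t)\<^sup>2"
    "Q2 t = (S t)\<^sup>2 - 8 * (a t - - b t) * a t * (- b t)\<^sup>2"
    unfolding Q1_def Q2_def P by (simp_all add: algebra_simps)
  have comm: "4 * - b t * a t = 4 * a t * (- b t)" by simp
  note 1 = dipole_drift_bound[OF pos(2,1) R(2) separation_pos(1)] and
    2 = dipole_drift_bound[OF pos R(1) separation_pos(1)]
  show "Q1 t \<ge> 0 \<and> Q2 t \<ge> 0" if "4 * a t * (- b t) \<le> golden_ratio * S t"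
    unfolding Q using 1(1)[unfolded comm, OF that] 2(1)[OF that] by linarith
  show "Q1 t > 0 \<and> Q2 t > 0" if lt: "4 * a t * (- b t) < golden_ratio * S t"
    unfolding Q using 1(2)[unfolded comm, OF less_imp_le[OF lt] lt] 2(2)[OF less_imp_le[OF lt] lt]
    by linarith
qed

text \<open>
  The condition of the previous estimate holds for weak interaction, and for every \<open>W > 1\<close> when the
  vortices are far apart.
\<close>

lemma dipole_velocity_nonneg:
  assumes \<sigma>1: "\<sigma> = - 1"
  shows "golden_ratio \<le> W t \<Longrightarrow> Q1 t \<ge> 0 \<and> Q2 t \<ge> 0"
    and "golden_ratio < W t \<Longrightarrow> Q1 t > 0 \<and> Q2 t > 0"
    and "1 < W t \<Longrightarrow> 2 * P\<^sup>2 \<le> S t \<Longrightarrow> Q1 t > 0 \<and> Q2 t > 0"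
proof -
  define n where "n = 4 * a t * (- b t)"
  have n: "n > 0" and S: "S t > 0" "P\<^sup>2 \<le> S t"
    using dipole_facts(2,3)[OF \<sigma>1, of t] separation_pos[of t] by (auto simp: n_def)
  have w: "W t * (n * S t) = P\<^sup>2 * (n + S t)"
  proof -
    have "W t = P\<^sup>2 * (1 / n + 1 / S t)" using dipole_facts(4)[OF \<sigma>1, of t] by (simp add: n_def)
    then show ?thesis using n S by (simp add: field_simps)
  qed
  have wS: "W t * n \<le> n + S t"
  proof -
    have "S t * (W t * n) \<le> S t * (n + S t)"
      using w S n mult_right_mono[OF S(2), of "n + S t"] by (simp add: mult_ac)
    then show ?thesis using S by simp
  qed
  have unit: "golden_ratio * (golden_ratio - 1) = 1"
    using golden_ratio_square by (simp add: power2_eq_square algebra_simps)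
  have scale: "n \<le> golden_ratio * S t" "(golden_ratio - 1) * n < S t \<Longrightarrow> n < golden_ratio * S t"
    if "(golden_ratio - 1) * n \<le> S t"
    using mult_left_mono[OF that, of golden_ratio]
      mult_strict_left_mono[of "(golden_ratio - 1) * n" "S t" golden_ratio]
      golden_ratio_gt_1 unit by (auto simp flip: mult.assoc)
  show "Q1 t \<ge> 0 \<and> Q2 t \<ge> 0" if "golden_ratio \<le> W t"
  proof -
    have "golden_ratio * n \<le> W t * n" using that n by simp
    then have "(golden_ratio - 1) * n \<le> S t" using wS by (simp add: algebra_simps)
    from dipole_velocity_bound(1)[OF \<sigma>1, of t, folded n_def, OF scale(1)[OF this]] show ?thesis .
  qed
  show "Q1 t > 0 \<and> Q2 t > 0" if "golden_ratio < W t"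
  proof -
    have "golden_ratio * n < W t * n" using that n by simp
    then have lt: "(golden_ratio - 1) * n < S t" using wS by (simp add: algebra_simps)
    from dipole_velocity_bound(2)[OF \<sigma>1, of t, folded n_def, OF scale(2)[OF less_imp_le[OF lt] lt]]
    show ?thesis .
  qed
  show "Q1 t > 0 \<and> Q2 t > 0" if "1 < W t" "2 * P\<^sup>2 \<le> S t"
  proof -
    have "2 * (n * S t) < 2 * (W t * (n * S t))" using that n S by simp
    also have "\<dots> = 2 * P\<^sup>2 * (n + S t)" by (simp add: w)
    also have "\<dots> \<le> S t * (n + S t)" using that n S by (intro mult_right_mono) auto
    finally have "S t * n < S t * S t" by (simp add: algebra_simps)
    then have "n < S t" using S by simp
    also have "S t \<le> golden_ratio * S t" using golden_ratio_gt_1 S by simp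
    finally show ?thesis using dipole_velocity_bound(2)[OF \<sigma>1, of t, folded n_def] by blast
  qed
qed

text \<open>
  The vortex nearer to the boundary moves on the vertical against its direction at large distance
  exactly when \<open>W < \<phi>\<close>.
\<close>

lemma dipole_sgn_on_vertical:
  assumes \<sigma>1: "\<sigma> = - 1" and X: "X t = 0"
  shows "P > 0 \<Longrightarrow> sgn (Q2 t) = sgn (W t - golden_ratio)"
    "P < 0 \<Longrightarrow> sgn (Q1 t) = sgn (W t - golden_ratio)"
proof -
  have pos: "a t > 0" "- b t > 0" using a_pos dipole_facts(1)[OF \<sigma>1, of t] by auto
  note v = on_vertical[OF X]
  have W: "W t - golden_ratio = (a t - - b t)\<^sup>2 / (4 * a t * (- b t)) - (golden_ratio - 1)"
    "W t - golden_ratio = (- b t - a t)\<^sup>2 / (4 * (- b t) * a t) - (golden_ratio - 1)"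
    using dipole_W_gt_1(1)[OF \<sigma>1 X] power2_commute[of "- b t" "a t"] by (simp_all add: mult_ac)
  show "sgn (Q2 t) = sgn (W t - golden_ratio)" if P: "P > 0"
  proof -
    have "Q2 t = P * (a t - b t) * ((a t)\<^sup>2 - 4 * a t * (- b t) - (- b t)\<^sup>2)"
      unfolding v(2) by (simp add: algebra_simps)
    moreover have "a t - b t > 0" using pos by simp
    ultimately have "sgn (Q2 t) = sgn ((a t)\<^sup>2 - 4 * a t * (- b t) - (- b t)\<^sup>2)"
      using P by (simp add: sgn_mult)
    also have "\<dots> = sgn (W t - golden_ratio)"
    proof (rule sgn_eqI)
      have "- b t < a t" using momentum[of t] P by linarith
      from cusp_ratio[OF this pos(2)]
      show "(a t)\<^sup>2 - 4 * a t * (- b t) - (- b t)\<^sup>2 < 0 \<longleftrightarrow> W t - golden_ratio < 0"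
        "(a t)\<^sup>2 - 4 * a t * (- b t) - (- b t)\<^sup>2 = 0 \<longleftrightarrow> W t - golden_ratio = 0"
        unfolding W(1) by linarith+
    qed
    finally show ?thesis .
  qed
  show "sgn (Q1 t) = sgn (W t - golden_ratio)" if P: "P < 0"
  proof -
    have "Q1 t = - P * (a t - b t) * ((- b t)\<^sup>2 - 4 * (- b t) * a t - (a t)\<^sup>2)"
      unfolding v(1) by (simp add: algebra_simps)
    moreover have "a t - b t > 0" using pos by simp
    ultimately have "sgn (Q1 t) = sgn ((- b t)\<^sup>2 - 4 * (- b t) * a t - (a t)\<^sup>2)"
      using P by (simp add: sgn_mult)
    also have "\<dots> = sgn (W t - golden_ratio)"
    proof (rule sgn_eqI)
      have "a t < - b t" using momentum[of t] P by linarith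
      from cusp_ratio[OF this pos(1)]
      show "(- b t)\<^sup>2 - 4 * (- b t) * a t - (a t)\<^sup>2 < 0 \<longleftrightarrow> W t - golden_ratio < 0"
        "(- b t)\<^sup>2 - 4 * (- b t) * a t - (a t)\<^sup>2 = 0 \<longleftrightarrow> W t - golden_ratio = 0"
        unfolding W(2) by linarith+
    qed
    finally show ?thesis .
  qed
qed

end

section \<open>Existence of motions\<close>

text \<open>
  A scalar equation \<open>\<theta>' = \<omega> \<theta>\<close> with positive continuous bounded right-hand side is solved on the
  whole line by the inverse of the travel time, an antiderivative of \<open>1 / \<omega>\<close>.  The bound on \<open>\<omega>\<close>
  makes the travel time surjective.
\<close>

lemma autonomous_ode_global_solution:
  fixes \<omega> :: "real \<Rightarrow> real"
  assumes cont: "\<And>x. isCont \<omega> x" and pos: "\<And>x. 0 < \<omega> x" and le: "\<And>x. \<omega> x \<le> M"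
  obtains \<theta> where "\<And>t. (\<theta> has_real_derivative \<omega> (\<theta> t)) (at t)"
proof -
  have M: "M > 0" using pos[of 0] le[of 0] by linarith
  have "isCont (\<lambda>x. 1 / \<omega> x) x" for x
    using cont pos by (intro continuous_intros) (auto simp: less_imp_neq[symmetric])
  then have "\<exists>F. \<forall>x. - \<infinity> < ereal x \<longrightarrow> ereal x < \<infinity> \<longrightarrow> (F has_vector_derivative 1 / \<omega> x) (at x)"
    by (intro einterval_antiderivative) auto
  then obtain F where F: "\<And>x. (F has_real_derivative 1 / \<omega> x) (at x)"
    by (auto simp: has_real_derivative_iff_has_vector_derivative)
  have growth: "F x + 1 / M * (y - x) \<le> F y" if "x \<le> y" for x y
    using that F le pos M by (intro DERIV_linear_growth[where f' = "\<lambda>x. 1 / \<omega> x"]) (auto intro!: frac_le)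
  have cF: "isCont F x" for x using F DERIV_isCont by blast
  have "strict_mono F"
  proof (rule strict_monoI)
    fix x y :: real assume "x < y"
    moreover from this have "1 / M * (y - x) > 0" using M by simp
    ultimately show "F x < F y" using growth[of x y] by simp
  qed
  then have inj: "inj F" by (rule strict_mono_imp_inj_on)
  have "\<exists>x. F x = y" for y
  proof -
    define r where "r = M * \<bar>y - F 0\<bar>"
    have r: "0 \<le> r" "r / M = \<bar>y - F 0\<bar>" using M by (auto simp: r_def)
    have "F (- r) \<le> y" "y \<le> F r" using growth[of "- r" 0] growth[of 0 r] r by auto
    then have "\<exists>x. - r \<le> x \<and> x \<le> r \<and> F x = y"
      using r cF by (intro IVT) auto
    then show ?thesis by blast
  qed
  then have "surj F" by (metis surj_def)
  define \<theta> where "\<theta> = inv F"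
  have left: "\<theta> (F x) = x" and right: "F (\<theta> t) = t" for x t
    using inj \<open>surj F\<close> by (simp_all add: \<theta>_def surj_f_inv_f)
  have "isCont \<theta> (F x)" for x
    by (rule isCont_inverse_function[of 1 x]) (use left cF in auto)
  then have c\<theta>: "isCont \<theta> t" for t by (metis right)
  have "(\<theta> has_real_derivative inverse (1 / \<omega> (\<theta> t))) (at t)" for t
    by (rule DERIV_inverse_function[where f = F and a = "t - 1" and b = "t + 1"])
       (use F right c\<theta> pos[of "\<theta> t"] in auto)
  then show thesis by (intro that[of \<theta>]) simp
qed

text \<open>
  Given the reduced coordinates, the horizontal position of the second vortex is found by
  integrating its drift.
\<close>

lemma motion_from_reduced:
  fixes a b X :: "real \<Rightarrow> real"
  assumes \<sigma>: "\<sigma> = 1 \<or> \<sigma> = - 1"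
    and pos: "\<And>t. a t > 0" "\<And>t. \<sigma> * b t > 0"
    and S: "\<And>t. (X t)\<^sup>2 + (a t + b t)\<^sup>2 > 0" and D: "\<And>t. (X t)\<^sup>2 + (a t - b t)\<^sup>2 > 0"
    and da: "\<And>t. (a has_real_derivative climb (a t) (b t) (X t)) (at t)"
    and db: "\<And>t. (b has_real_derivative - climb (a t) (b t) (X t)) (at t)"
    and dX: "\<And>t. (X has_real_derivative
      - (a t - b t) * ((X t)\<^sup>2 + (a t + b t)\<^sup>2) / (4 * pi * a t * b t * ((X t)\<^sup>2 + (a t - b t)\<^sup>2))) (at t)"
    and w: "\<And>t. w = \<sigma> * (a t + b t)\<^sup>2 * (1 / (4 * a t * b t) - 1 / ((X t)\<^sup>2 + (a t + b t)\<^sup>2))"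
  shows "\<exists>z1 z2. vortex_motion 1 \<sigma> z1 z2 \<and> (\<forall>t. interaction_parameter 1 \<sigma> (z1 t) (z2 t) = w)"
proof -
  have bnz: "b t \<noteq> 0" for t using pos(2)[of t] by auto
  have \<sigma>\<sigma>: "\<sigma> * (\<sigma> * x) = x" for x using \<sigma> by auto
  have cont: "isCont a t" "isCont b t" "isCont X t" for t
    using da db dX DERIV_isCont by blast+
  have "isCont (\<lambda>t. drift (b t) (a t) (X t)) t" for t
    unfolding drift_def using bnz[of t] S[of t] D[of t]
    by (intro continuous_intros cont) (auto simp: add.commute power2_commute)
  then have "\<exists>F. \<forall>x. - \<infinity> < ereal x \<longrightarrow> ereal x < \<infinity> \<longrightarrow>
      (F has_vector_derivative drift (b x) (a x) (X x)) (at x)"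
    by (intro einterval_antiderivative) auto
  then obtain x2 where x2: "\<And>t. (x2 has_real_derivative drift (b t) (a t) (X t)) (at t)"
    by (auto simp: has_real_derivative_iff_has_vector_derivative)
  define z1 where "z1 t = Complex (X t + x2 t) (a t)" for t
  define z2 where "z2 t = Complex (x2 t) (\<sigma> * b t)" for t
  have d1: "(z1 has_vector_derivative Complex (drift (a t) (b t) (X t)) (climb (a t) (b t) (X t))) (at t)" for t
  proof -
    have "drift (a t) (b t) (X t) - drift (b t) (a t) (X t) = - (a t - b t) * ((X t)\<^sup>2 + (a t + b t)\<^sup>2)
        / (4 * pi * a t * b t * ((X t)\<^sup>2 + (a t - b t)\<^sup>2))"
      using pos(1)[of t] bnz[of t] S[of t] D[of t] by (intro drift_diff) auto
    with DERIV_add[OF dX[of t] x2[of t]]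
    have "((\<lambda>t. X t + x2 t) has_real_derivative drift (a t) (b t) (X t)) (at t)"
      by (elim DERIV_cong) linarith
    with da[of t] show ?thesis
      by (simp add: has_vector_derivative_complex_iff z1_def)
  qed
  have d2: "(z2 has_vector_derivative Complex (drift (b t) (a t) (X t)) (- \<sigma> * climb (a t) (b t) (X t))) (at t)" for t
    using x2[of t] DERIV_cmult[OF db[of t], of \<sigma>]
    by (simp add: has_vector_derivative_complex_iff z2_def)
  have distinct: "z1 t \<noteq> z2 t" for t
  proof
    assume "z1 t = z2 t"
    then have "X t = 0" "a t = \<sigma> * b t" by (auto simp: z1_def z2_def)
    with S[of t] D[of t] \<sigma> show False by auto
  qed
  have motion: "vortex_motion 1 \<sigma> z1 z2"
    unfolding vortex_motion_iff[OF \<sigma>]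
  proof (intro allI conjI)
    fix t
    show "Im (z1 t) > 0" "Im (z2 t) > 0" "z1 t \<noteq> z2 t"
      using pos distinct by (auto simp: z1_def z2_def)
    show "z1 differentiable at t" "z2 differentiable at t"
      using d1 d2 by (auto intro: differentiableI_vector)
    have c: "Im (z1 t) = a t" "\<sigma> * Im (z2 t) = b t" "Re (z1 t) - Re (z2 t) = X t"
      by (simp_all add: z1_def z2_def \<sigma>\<sigma>)
    show "velocity z1 t = Complex (drift (Im (z1 t)) (\<sigma> * Im (z2 t)) (Re (z1 t) - Re (z2 t)))
        (climb (Im (z1 t)) (\<sigma> * Im (z2 t)) (Re (z1 t) - Re (z2 t)))"
      "velocity z2 t = Complex (drift (\<sigma> * Im (z2 t)) (Im (z1 t)) (Re (z1 t) - Re (z2 t)))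
        (- \<sigma> * climb (Im (z1 t)) (\<sigma> * Im (z2 t)) (Re (z1 t) - Re (z2 t)))"
      unfolding c velocity_def using d1 d2 by (auto intro: vector_derivative_at)
  qed
  interpret M: mirror_motion \<sigma> z1 z2
    using \<sigma> motion by unfold_locales
  have "interaction_parameter 1 \<sigma> (z1 t) (z2 t) = w" for t
  proof -
    have c: "M.a t = a t" "M.b t = b t" "M.X t = X t"
      by (simp_all add: M.a_def M.b_def M.X_def z1_def z2_def \<sigma>\<sigma>)
    have "M.W t = \<sigma> * (M.a t + M.b t)\<^sup>2 * (1 / (4 * M.a t * M.b t) - 1 / M.S t)"
      by (simp only: M.momentum M.energy M.W_eq)
    then show ?thesis using w[of t] by (simp only: M.S_def M.W_def c)
  qed
  with motion show ?thesis by blast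
qed

lemma climb_alt:
  "climb a b X = X * (4 * a * b) / (2 * pi * (X\<^sup>2 + (a + b)\<^sup>2) * (X\<^sup>2 + (a - b)\<^sup>2))"
proof -
  have "X * (4 * a * b) = 2 * (2 * X * a * b)"
    "2 * pi * (X\<^sup>2 + (a + b)\<^sup>2) * (X\<^sup>2 + (a - b)\<^sup>2)
      = 2 * (pi * (X\<^sup>2 + (a + b)\<^sup>2) * (X\<^sup>2 + (a - b)\<^sup>2))"
    by simp_all
  then show ?thesis
    unfolding climb_def by (simp only: mult_divide_mult_cancel_left[OF zero_neq_numeral[symmetric]])
qed

text \<open>
  For \<open>P = 1\<close> the level curve \<open>1 / (4 * a * b) - 1 / S = w\<close> in the coordinates \<open>s = a - b\<close> and \<open>X\<close> is
  parametrized by an angle: \<open>s\<close> is \<open>k * sin \<theta>\<close>, with \<open>k\<close> its largest value, and then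
  \<open>m = 4 * a * b = 1 - s\<^sup>2\<close> determines \<open>X\<close> up to its sign, which is that of \<open>cos \<theta>\<close>.  The equation for \<open>s\<close> prescribes the angular speed
  \<open>\<omega>\<close>; the equation for \<open>X\<close> then holds because the curve is a level curve.
\<close>

lemma pair_motion_exists:
  assumes w: "0 < w" "w < 1"
  shows "\<exists>z1 z2. vortex_motion 1 1 z1 z2 \<and> (\<forall>t. interaction_parameter 1 1 (z1 t) (z2 t) = w)"
proof -
  define k where "k = sqrt (w / (1 + w))"
  have k: "k > 0" "k\<^sup>2 = w / (1 + w)" using w by (auto simp: k_def)
  define m where "m x = 1 - k\<^sup>2 * (sin x)\<^sup>2" for x
  define u where "u x = 1 - w * m x" for x
  define q where "q x = sqrt (w / u x)" for x
  define \<omega> where "\<omega> x = q x * (u x)\<^sup>2 / (pi * k * w * (m x)\<^sup>2)" for x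
  have k1: "k\<^sup>2 < 1" using w by (simp add: k(2))
  have m: "1 - k\<^sup>2 \<le> m x" "m x \<le> 1" for x
    using mult_left_le[of "(sin x)\<^sup>2" "k\<^sup>2"] by (auto simp: m_def abs_square_le_1)
  have m0: "0 < m x" for x using m(1)[of x] k1 by linarith
  have wm: "w * m x \<le> w" "0 < w * m x" for x using m(2)[of x] m0[of x] w by (auto simp: mult_left_le)
  have u: "1 - w \<le> u x" "u x < 1" "0 < u x" for x
    using wm[of x] w unfolding u_def by linarith+
  have q: "0 < q x" "(q x)\<^sup>2 * u x = w" for x
    using u(3)[of x] w by (auto simp: q_def)
  have "isCont \<omega> x" for x
    unfolding \<omega>_def q_def u_def m_def using m0[of x] u(3)[of x] k w
    by (intro continuous_intros) (auto simp: u_def m_def)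
  moreover have "0 < \<omega> x" for x
    unfolding \<omega>_def using q(1)[of x] u(3)[of x] m0[of x] k w by simp
  moreover have "\<omega> x \<le> sqrt (w / (1 - w)) * 1 / (pi * k * w * (1 - k\<^sup>2)\<^sup>2)" for x
  proof -
    have "q x \<le> sqrt (w / (1 - w))"
      unfolding q_def using u[of x] w by (intro real_sqrt_le_mono frac_le) auto
    moreover have "(u x)\<^sup>2 \<le> 1" using u[of x] by (simp add: abs_square_le_1)
    moreover have "(1 - k\<^sup>2)\<^sup>2 \<le> (m x)\<^sup>2" using m[of x] k1 by (intro power_mono) auto
    ultimately show ?thesis
      unfolding \<omega>_def using k k1 w q(1)[of x] by (intro frac_le mult_mono mult_left_mono) auto
  qed
  ultimately obtain \<theta> where \<theta>: "\<And>t. (\<theta> has_real_derivative \<omega> (\<theta> t)) (at t)"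
    using autonomous_ode_global_solution by metis
  define s where "s t = k * sin (\<theta> t)" for t
  define X where "X t = cos (\<theta> t) * q (\<theta> t)" for t
  define a where "a t = (1 + s t) / 2" for t
  define b where "b t = (1 - s t) / 2" for t
  have s2: "(s t)\<^sup>2 = 1 - m (\<theta> t)" for t by (simp add: s_def m_def power_mult_distrib)
  have sum: "a t + b t = 1" and diff: "a t - b t = s t" for t by (simp_all add: a_def b_def field_simps)
  have ab: "4 * a t * b t = m (\<theta> t)" for t
  proof -
    have "4 * a t * b t = 1 - (s t)\<^sup>2"
      by (simp add: a_def b_def power2_eq_square field_simps)
    then show ?thesis by (simp add: s2)
  qed
  have "\<bar>s t\<bar> < 1" for t using s2[of t] m0[of "\<theta> t"] by (simp flip: abs_square_less_1)
  then have "- 1 < s t" "s t < 1" for t by (auto simp: abs_less_iff minus_less_iff)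
  then have pos: "a t > 0" "b t > 0" for t
    using sum diff by (smt (verit))+
  have u_cos: "u x + w * k\<^sup>2 * (cos x)\<^sup>2 = k\<^sup>2 / w" for x
  proof -
    have "u x + w * k\<^sup>2 * (cos x)\<^sup>2 = 1 - w + w * k\<^sup>2 * ((sin x)\<^sup>2 + (cos x)\<^sup>2)"
      unfolding u_def m_def by algebra
    also have "\<dots> = 1 - w + w * (w / (1 + w))" by (simp add: k(2))
    also have "\<dots> = 1 / (1 + w)" using w by (simp add: field_simps)
    finally show ?thesis using w by (simp add: k(2))
  qed
  have S: "(X t)\<^sup>2 + (a t + b t)\<^sup>2 = m (\<theta> t) / u (\<theta> t)" for t
  proof -
    have "(X t)\<^sup>2 * u (\<theta> t) = (cos (\<theta> t))\<^sup>2 * w"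
      using q(2)[of "\<theta> t"] by (simp add: X_def power_mult_distrib mult.assoc)
    also have "\<dots> = m (\<theta> t) - u (\<theta> t)"
    proof -
      have "k\<^sup>2 * (1 + w) = w" using w by (simp add: k(2))
      moreover have "m x - u x = w - k\<^sup>2 * (1 + w) * (sin x)\<^sup>2" for x
        by (simp add: u_def m_def algebra_simps)
      ultimately have "m x - u x = w * (cos x)\<^sup>2" for x
        by (simp add: cos_squared_eq right_diff_distrib)
      then show ?thesis by simp
    qed
    finally show ?thesis using u(3)[of "\<theta> t"] by (simp add: sum field_simps)
  qed
  have D: "(X t)\<^sup>2 + (a t - b t)\<^sup>2 = w * (m (\<theta> t))\<^sup>2 / u (\<theta> t)" for t
  proof -
    have "(X t)\<^sup>2 + (a t - b t)\<^sup>2 = (X t)\<^sup>2 + (a t + b t)\<^sup>2 - m (\<theta> t)"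
      by (simp add: sum diff s2)
    also have "\<dots> = w * (m (\<theta> t))\<^sup>2 / u (\<theta> t)"
      unfolding S using u(3)[of "\<theta> t"] by (simp add: field_simps) (simp add: u_def power2_eq_square algebra_simps)
    finally show ?thesis .
  qed
  have climb: "climb (a t) (b t) (X t) = X t * (u (\<theta> t))\<^sup>2 / (2 * pi * w * (m (\<theta> t))\<^sup>2)" for t
  proof -
    have "climb (a t) (b t) (X t) = X t * (4 * a t * b t)
        / (2 * pi * ((X t)\<^sup>2 + (a t + b t)\<^sup>2) * ((X t)\<^sup>2 + (a t - b t)\<^sup>2))"
      by (rule climb_alt)
    also have "\<dots> = X t * (u (\<theta> t))\<^sup>2 / (2 * pi * w * (m (\<theta> t))\<^sup>2)"
      unfolding S D ab using m0[of "\<theta> t"] u(3)[of "\<theta> t"] w by (simp add: field_simps power2_eq_square)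
    finally show ?thesis .
  qed
  have ds: "(s has_real_derivative 2 * climb (a t) (b t) (X t)) (at t)" for t
  proof -
    have "(s has_real_derivative k * (cos (\<theta> t) * \<omega> (\<theta> t))) (at t)"
      unfolding s_def[abs_def] by (auto intro!: derivative_eq_intros \<theta>)
    moreover have "k * (cos (\<theta> t) * \<omega> (\<theta> t)) = 2 * climb (a t) (b t) (X t)"
      unfolding climb \<omega>_def using k by (simp add: X_def)
    ultimately show ?thesis by simp
  qed
  have da: "(a has_real_derivative climb (a t) (b t) (X t)) (at t)" for t
  proof -
    have "((\<lambda>t. (1 + s t) / 2) has_real_derivative climb (a t) (b t) (X t)) (at t)"
      by (auto intro!: derivative_eq_intros ds)
    then show ?thesis by (simp only: a_def[symmetric])
  qed
  have db: "(b has_real_derivative - climb (a t) (b t) (X t)) (at t)" for t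
  proof -
    have "((\<lambda>t. (1 - s t) / 2) has_real_derivative - climb (a t) (b t) (X t)) (at t)"
      by (auto intro!: derivative_eq_intros ds)
    then show ?thesis by (simp only: b_def[symmetric])
  qed
  have dX: "(X has_real_derivative - (a t - b t) * ((X t)\<^sup>2 + (a t + b t)\<^sup>2)
      / (4 * pi * a t * b t * ((X t)\<^sup>2 + (a t - b t)\<^sup>2))) (at t)" for t
  proof -
    define x where "x = \<theta> t"
    note pos' = m0[of x] u(3)[of x] q(1)[of x] k(1) w(1)
    have du: "((\<lambda>t. u (\<theta> t)) has_real_derivative 2 * w * k\<^sup>2 * sin x * cos x * \<omega> x) (at t)"
      unfolding u_def m_def x_def by (auto intro!: derivative_eq_intros \<theta>)
    have dq: "((\<lambda>t. q (\<theta> t)) has_real_derivative - (w * k * sin x * cos x) / (pi * (m x)\<^sup>2)) (at t)"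
    proof -
      have "((\<lambda>t. sqrt (w / u (\<theta> t))) has_real_derivative
          (- w * (2 * w * k\<^sup>2 * sin x * cos x * \<omega> x) / (u x * u x)) * (inverse (sqrt (w / u x)) / 2)) (at t)"
        using pos' less_imp_le[OF divide_pos_pos[OF w(1) u(3)[of x]]] unfolding x_def
        by (auto intro!: derivative_eq_intros du[unfolded x_def] simp flip: not_le)
      moreover have "(- w * (2 * w * k\<^sup>2 * sin x * cos x * \<omega> x) / (u x * u x)) * (inverse (q x) / 2)
          = - (w * k * sin x * cos x) / (pi * (m x)\<^sup>2)"
        unfolding \<omega>_def using pos' by (simp add: field_simps power2_eq_square)
      ultimately show ?thesis unfolding q_def by simp
    qed
    have "(X has_real_derivative
        - sin x * \<omega> x * q x + cos x * (- (w * k * sin x * cos x) / (pi * (m x)\<^sup>2))) (at t)"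
      unfolding X_def[abs_def] x_def
      by (auto intro!: derivative_eq_intros \<theta> dq[unfolded x_def])
    moreover have "- sin x * \<omega> x * q x + cos x * (- (w * k * sin x * cos x) / (pi * (m x)\<^sup>2))
        = - (sin x / (pi * k * (m x)\<^sup>2)) * (u x + w * k\<^sup>2 * (cos x)\<^sup>2)"
    proof -
      have "\<omega> x * q x = ((q x)\<^sup>2 * u x) * u x / (pi * k * w * (m x)\<^sup>2)"
        by (simp add: \<omega>_def power2_eq_square)
      also have "\<dots> = u x / (pi * k * (m x)\<^sup>2)" unfolding q(2) using pos' by simp
      finally show ?thesis using pos' by (simp add: mult.assoc) (simp add: field_simps power2_eq_square)
    qed
    moreover have "\<dots> = - (a t - b t) * ((X t)\<^sup>2 + (a t + b t)\<^sup>2)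
        / (4 * pi * a t * b t * ((X t)\<^sup>2 + (a t - b t)\<^sup>2))"
    proof -
      have "4 * pi * a t * b t = pi * (4 * a t * b t)" by simp
      also have "\<dots> = pi * m x" by (simp only: ab x_def)
      finally have "4 * pi * a t * b t = pi * m x" .
      then show ?thesis
        unfolding S D unfolding diff u_cos using pos'
        by (simp add: s_def x_def[symmetric] field_simps power2_eq_square)
    qed
    ultimately show ?thesis by simp
  qed
  show ?thesis
  proof (rule motion_from_reduced[of 1 a b X])
    fix t
    show "0 < (X t)\<^sup>2 + (a t + b t)\<^sup>2" "0 < (X t)\<^sup>2 + (a t - b t)\<^sup>2"
      unfolding S D using m0[of "\<theta> t"] u(3)[of "\<theta> t"] w by auto
    show "w = 1 * (a t + b t)\<^sup>2 * (1 / (4 * a t * b t) - 1 / ((X t)\<^sup>2 + (a t + b t)\<^sup>2))"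
      unfolding S ab using m0[of "\<theta> t"] u(3)[of "\<theta> t"] by (simp add: sum field_simps u_def)
  qed (use pos da db dX in auto)
qed

text \<open>
  For \<open>P = 1\<close> the level curve of a dipole is a graph over \<open>X\<close>, with \<open>n = - 4 * a * b\<close> and
  \<open>p = a - b\<close> functions of \<open>X\<close>; the motion along it is a scalar equation for \<open>X\<close>.
\<close>

lemma dipole_motion_exists:
  assumes w: "1 < w"
  shows "\<exists>z1 z2. vortex_motion 1 (- 1) z1 z2 \<and> (\<forall>t. interaction_parameter 1 (- 1) (z1 t) (z2 t) = w)"
proof -
  define S where "S x = x\<^sup>2 + 1" for x :: real
  define n where "n x = S x / (w * S x - 1)" for x
  define p where "p x = sqrt (1 + n x)" for x
  define \<omega> where "\<omega> x = p x * S x / (pi * n x * (S x + n x))" for x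
  have S1: "1 \<le> S x" for x by (simp add: S_def)
  have den: "w * S x - 1 > 0" for x
    using mult_strict_right_mono[OF w, of "S x"] S1[of x] by linarith
  have n: "0 < n x" for x unfolding n_def using den[of x] S1[of x] by simp
  have inv_n: "1 / n x + 1 / S x = w" for x
    unfolding n_def using den[of x] S1[of x] by (simp add: field_simps)
  have p: "p x > 1" "(p x)\<^sup>2 = 1 + n x" for x
    using n[of x] by (auto simp: p_def)
  have "isCont \<omega> x" for x
  proof -
    have "isCont S x" unfolding S_def[abs_def] by (intro continuous_intros)
    moreover from this have "isCont n x" unfolding n_def[abs_def]
      using den[of x] by (intro continuous_intros) auto
    moreover from this have "isCont p x" unfolding p_def[abs_def] by (intro continuous_intros)
    ultimately show ?thesis
      unfolding \<omega>_def[abs_def] using n[of x] S1[of x] by (intro continuous_intros) auto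
  qed
  moreover have "0 < \<omega> x" for x
    unfolding \<omega>_def using n[of x] S1[of x] p(1)[of x] by simp
  moreover have "\<omega> x \<le> sqrt (1 + 1 / (w - 1)) / (pi * (1 / w))" for x
  proof -
    have "1 / S x \<le> 1" using S1[of x] by simp
    then have "w - 1 \<le> 1 / n x" using inv_n[of x] by linarith
    then have "n x \<le> 1 / (w - 1)" using n[of x] w by (simp add: field_simps)
    then have "p x \<le> sqrt (1 + 1 / (w - 1))" by (simp add: p_def)
    moreover have "1 / n x \<le> w" using inv_n[of x] S1[of x] by (simp add: flip: inv_n[of x])
    then have "1 / w \<le> n x" using n[of x] w by (simp add: field_simps)
    moreover have "p x * (S x / (S x + n x)) \<le> p x"
      using p(1)[of x] n[of x] S1[of x] by (intro mult_left_le) auto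
    ultimately have "p x * (S x / (S x + n x)) / (pi * n x) \<le> sqrt (1 + 1 / (w - 1)) / (pi * (1 / w))"
      using w by (intro frac_le mult_left_mono) auto
    then show ?thesis by (simp add: \<omega>_def mult_ac)
  qed
  ultimately obtain X where X: "\<And>t. (X has_real_derivative \<omega> (X t)) (at t)"
    using autonomous_ode_global_solution by metis
  define a where "a t = (1 + p (X t)) / 2" for t
  define b where "b t = (1 - p (X t)) / 2" for t
  have sum: "a t + b t = 1" and diff: "a t - b t = p (X t)" for t by (simp_all add: a_def b_def field_simps)
  have ab: "4 * a t * b t = - n (X t)" for t
  proof -
    have "4 * a t * b t = 1 - (p (X t))\<^sup>2"
      by (simp add: a_def b_def power2_eq_square field_simps)
    then show ?thesis by (simp add: p(2))
  qed
  have pos: "a t > 0" "b t < 0" for t using p(1)[of "X t"] by (auto simp: a_def b_def)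
  have S: "(X t)\<^sup>2 + (a t + b t)\<^sup>2 = S (X t)" for t by (simp add: sum S_def)
  have D: "(X t)\<^sup>2 + (a t - b t)\<^sup>2 = S (X t) + n (X t)" for t by (simp add: diff p(2) S_def)
  have climb: "climb (a t) (b t) (X t) = - X t * n (X t) / (2 * pi * S (X t) * (S (X t) + n (X t)))" for t
  proof -
    have "climb (a t) (b t) (X t) = X t * (4 * a t * b t)
        / (2 * pi * ((X t)\<^sup>2 + (a t + b t)\<^sup>2) * ((X t)\<^sup>2 + (a t - b t)\<^sup>2))"
      by (rule climb_alt)
    then show ?thesis unfolding S D ab by simp
  qed
  have dp: "((\<lambda>t. p (X t)) has_real_derivative 2 * climb (a t) (b t) (X t)) (at t)" for t
  proof -
    define x where "x = X t"
    note facts = n[of x] S1[of x] p(1)[of x] den[of x]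
    have dS: "((\<lambda>t. S (X t)) has_real_derivative 2 * x * \<omega> x) (at t)"
      unfolding S_def x_def by (auto intro!: derivative_eq_intros X)
    have "((\<lambda>t. n (X t)) has_real_derivative
        ((2 * x * \<omega> x) * (w * S x - 1) - S x * (w * (2 * x * \<omega> x))) / ((w * S x - 1) * (w * S x - 1))) (at t)"
      unfolding n_def x_def using den[of "X t"]
      by (auto intro!: derivative_eq_intros dS[unfolded x_def])
    moreover have "((2 * x * \<omega> x) * (w * S x - 1) - S x * (w * (2 * x * \<omega> x))) / ((w * S x - 1) * (w * S x - 1))
        = - 2 * x * \<omega> x * (n x)\<^sup>2 / (S x)\<^sup>2"
    proof -
      have num: "(2 * x * \<omega> x) * (w * S x - 1) - S x * (w * (2 * x * \<omega> x)) = - 2 * x * \<omega> x"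
        by (simp add: algebra_simps)
      have sq: "(n x)\<^sup>2 / (S x)\<^sup>2 = 1 / ((w * S x - 1) * (w * S x - 1))"
        unfolding n_def using facts by (simp add: power_divide power2_eq_square)
      have "- 2 * x * \<omega> x * (n x)\<^sup>2 / (S x)\<^sup>2 = - 2 * x * \<omega> x * ((n x)\<^sup>2 / (S x)\<^sup>2)"
        by (simp only: times_divide_eq_right)
      then show ?thesis unfolding num sq by (simp only: times_divide_eq_right mult_1_right)
    qed
    ultimately have dn: "((\<lambda>t. n (X t)) has_real_derivative - 2 * x * \<omega> x * (n x)\<^sup>2 / (S x)\<^sup>2) (at t)"
      by simp
    have "((\<lambda>t. sqrt (1 + n (X t))) has_real_derivative
        - 2 * x * \<omega> x * (n x)\<^sup>2 / (S x)\<^sup>2 * (inverse (sqrt (1 + n x)) / 2)) (at t)"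
      using n[of x] unfolding x_def
      by (auto intro!: derivative_eq_intros dn[unfolded x_def])
    moreover have "- 2 * x * \<omega> x * (n x)\<^sup>2 / (S x)\<^sup>2 * (inverse (p x) / 2) = 2 * climb (a t) (b t) (X t)"
    proof -
      define d where "d = S x + n x"
      have "d > 0" using facts by (simp add: d_def)
      then show ?thesis
        unfolding climb unfolding \<omega>_def x_def[symmetric] d_def[symmetric]
        using facts by (simp add: field_simps power2_eq_square)
    qed
    ultimately show ?thesis by (simp add: p_def)
  qed
  have da: "(a has_real_derivative climb (a t) (b t) (X t)) (at t)" for t
  proof -
    have "((\<lambda>t. (1 + p (X t)) / 2) has_real_derivative climb (a t) (b t) (X t)) (at t)"
      by (auto intro!: derivative_eq_intros dp)
    then show ?thesis by (simp only: a_def[symmetric])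
  qed
  have db: "(b has_real_derivative - climb (a t) (b t) (X t)) (at t)" for t
  proof -
    have "((\<lambda>t. (1 - p (X t)) / 2) has_real_derivative - climb (a t) (b t) (X t)) (at t)"
      by (auto intro!: derivative_eq_intros dp)
    then show ?thesis by (simp only: b_def[symmetric])
  qed
  show ?thesis
  proof (rule motion_from_reduced[of "- 1" a b X])
    fix t
    show "0 < (X t)\<^sup>2 + (a t + b t)\<^sup>2" "0 < (X t)\<^sup>2 + (a t - b t)\<^sup>2"
      unfolding S D using n[of "X t"] S1[of "X t"] by auto
    show "w = - 1 * (a t + b t)\<^sup>2 * (1 / (4 * a t * b t) - 1 / ((X t)\<^sup>2 + (a t + b t)\<^sup>2))"
      unfolding S ab using inv_n[of "X t"] by (simp add: sum)
    have "4 * pi * a t * b t = pi * (4 * a t * b t)" by simp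
    also have "\<dots> = - (pi * n (X t))" unfolding ab by simp
    finally have "4 * pi * a t * b t = - (pi * n (X t))" .
    then have "- (a t - b t) * ((X t)\<^sup>2 + (a t + b t)\<^sup>2)
        / (4 * pi * a t * b t * ((X t)\<^sup>2 + (a t - b t)\<^sup>2)) = \<omega> (X t)"
      unfolding S D unfolding diff \<omega>_def by simp
    then show "(X has_real_derivative - (a t - b t) * ((X t)\<^sup>2 + (a t + b t)\<^sup>2)
        / (4 * pi * a t * b t * ((X t)\<^sup>2 + (a t - b t)\<^sup>2))) (at t)"
      using X[of t] by simp
  qed (use pos da db in auto)
qed

section \<open>Types of motion and the bifurcation values\<close>

context mirror_motion
begin

lemma W_const: "W s = W t"
  by (simp only: W_eq)

lemma turns_back_iff:
  "turns_back z1 \<longleftrightarrow> (\<exists>t. Q1 t > 0) \<and> (\<exists>t. Q1 t < 0)"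
  "turns_back z2 \<longleftrightarrow> (\<exists>t. Q2 t > 0) \<and> (\<exists>t. Q2 t < 0)"
proof -
  have "Re (velocity z1 t) > 0 \<longleftrightarrow> Q1 t > 0" "Re (velocity z1 t) < 0 \<longleftrightarrow> Q1 t < 0" for t
    using sgn_velocity1[of t] by (metis sgn_1_pos, metis sgn_1_neg)
  then show "turns_back z1 \<longleftrightarrow> (\<exists>t. Q1 t > 0) \<and> (\<exists>t. Q1 t < 0)"
    by (simp add: turns_back_def)
  have v2: "sgn (\<sigma> * Re (velocity z2 t)) = sgn (Q2 t)" for t
    using sgn_velocity2[of t] \<sigma> by (auto simp: sgn_mult)
  have "\<sigma> * Re (velocity z2 t) > 0 \<longleftrightarrow> Q2 t > 0" "\<sigma> * Re (velocity z2 t) < 0 \<longleftrightarrow> Q2 t < 0" for t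
    using v2[of t] by (metis sgn_1_pos, metis sgn_1_neg)
  moreover have "turns_back z2 \<longleftrightarrow>
      (\<exists>t. \<sigma> * Re (velocity z2 t) > 0) \<and> (\<exists>t. \<sigma> * Re (velocity z2 t) < 0)"
    using \<sigma> by (auto simp: turns_back_def)
  ultimately show "turns_back z2 \<longleftrightarrow> (\<exists>t. Q2 t > 0) \<and> (\<exists>t. Q2 t < 0)"
    by simp
qed

lemma graph_like_iff:
  "graph_like z1 \<longleftrightarrow> (\<forall>t. Q1 t \<noteq> 0)" "graph_like z2 \<longleftrightarrow> (\<forall>t. Q2 t \<noteq> 0)"
proof -
  have "Re (velocity z1 t) = 0 \<longleftrightarrow> Q1 t = 0" "Re (velocity z2 t) = 0 \<longleftrightarrow> Q2 t = 0" for t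
    using sgn_velocity1[of t] sgn_velocity2[of t] \<sigma> by (auto simp: sgn_0_0 sgn_zero_iff)
  then show "graph_like z1 \<longleftrightarrow> (\<forall>t. Q1 t \<noteq> 0)" "graph_like z2 \<longleftrightarrow> (\<forall>t. Q2 t \<noteq> 0)"
    by (simp_all add: graph_like_def)
qed

text \<open>
  The horizontal velocity is continuous, so a vortex that moves both ways has a vertical tangent
  or a stop.
\<close>

lemma turns_back_imp_not_graph_like:
  "turns_back z1 \<Longrightarrow> \<not> graph_like z1" "turns_back z2 \<Longrightarrow> \<not> graph_like z2"
proof -
  have zero: "\<exists>t. f t = 0" if "continuous_on UNIV f" "f u > 0" "f v < 0" for f :: "real \<Rightarrow> real" and u v
  proof -
    have "connected (range f)" using that(1) by (rule connected_continuous_image) simp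
    then have "0 \<in> range f"
      by (rule connectedD_interval[of _ "f v" "f u"]) (use that in simp_all)
    then show ?thesis by force
  qed
  have "continuous_on UNIV Q1" "continuous_on UNIV Q2"
    unfolding Q1_def[abs_def] Q2_def[abs_def] S_eq
    by (intro continuous_intros continuous_heights)+
  then show "turns_back z1 \<Longrightarrow> \<not> graph_like z1" "turns_back z2 \<Longrightarrow> \<not> graph_like z2"
    unfolding turns_back_iff graph_like_iff using zero by blast+
qed

lemma has_cusp_iff: "has_cusp z1 z2 \<longleftrightarrow> (\<exists>t. X t = 0 \<and> (Q1 t = 0 \<or> Q2 t = 0))"
  unfolding has_cusp_def using velocity_zero_imp velocity_zeroI by blast

lemma pair_cusp_value:
  assumes "\<sigma> = 1" "X t = 0" "Q1 t = 0 \<or> Q2 t = 0"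
  shows "W t = 1 / golden_ratio"
proof (cases "b t < a t")
  case True
  with pair_sgn_on_vertical(1,2)[OF assms(1,2)] assms(3) have "sgn (W t - 1 / golden_ratio) = 0" by auto
  then show ?thesis by (simp only: sgn_0_0 right_minus_eq)
next
  case False
  then have "a t < b t" using on_vertical(5)[OF assms(2)] by simp
  with pair_sgn_on_vertical(3,4)[OF assms(1,2)] assms(3) have "sgn (W t - 1 / golden_ratio) = 0" by auto
  then show ?thesis by (simp only: sgn_0_0 right_minus_eq)
qed

lemma pair_classification:
  assumes \<sigma>1: "\<sigma> = 1"
  shows "leap_frogging z1 z2 \<longleftrightarrow> W t < 1 / golden_ratio"
    and "has_cusp z1 z2 \<longleftrightarrow> W t = 1 / golden_ratio"
    and "smooth_intertwining z1 z2 \<longleftrightarrow> 1 / golden_ratio < W t \<and> W t < 1"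
proof -
  have g: "1 / golden_ratio < 1" using golden_ratio_gt_1 by simp
  have alt_iff: "vortices_alternate z1 z2 \<longleftrightarrow> W t < 1"
    using pair_alternate_imp_W_less_1[OF \<sigma>1] pair_alternate(1)[OF \<sigma>1] W_const[of 0 t] by auto
  have zeros: "\<exists>u v. X u = 0 \<and> b u < a u \<and> X v = 0 \<and> a v < b v" if "W t < 1"
    using pair_alternate(2,3)[OF \<sigma>1] that W_const[of 0 t] by auto
  have turning: "turns_back z1 \<and> turns_back z2" if w: "W t < 1 / golden_ratio"
  proof -
    obtain u v where u: "X u = 0" "b u < a u" and v: "X v = 0" "a v < b v"
      using zeros w g by force
    have "sgn (W u - 1 / golden_ratio) = - 1" "sgn (W v - 1 / golden_ratio) = - 1"
      using w W_const[of t u] W_const[of t v] by (simp_all only: sgn_1_neg diff_less_0_iff_less)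
    then have "Q1 u < 0" "Q2 v < 0"
      using pair_sgn_on_vertical(1)[OF \<sigma>1 u] pair_sgn_on_vertical(3)[OF \<sigma>1 v] by (simp_all add: sgn_1_neg)
    moreover have "Q2 u > 0" "Q1 v > 0"
      using pair_sgn_on_vertical(2)[OF \<sigma>1 u] pair_sgn_on_vertical(4)[OF \<sigma>1 v] by auto
    ultimately show ?thesis unfolding turns_back_iff by blast
  qed
  have not_turning: "\<not> turns_back z1" if "1 / golden_ratio \<le> W t"
    unfolding turns_back_iff using pair_velocity_nonneg(1)[OF \<sigma>1] that W_const[of t]
    by (metis not_le)
  show "leap_frogging z1 z2 \<longleftrightarrow> W t < 1 / golden_ratio"
    unfolding leap_frogging_def alt_iff using turning not_turning g by (meson less_trans not_le)
  show cusp_iff: "has_cusp z1 z2 \<longleftrightarrow> W t = 1 / golden_ratio"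
  proof
    assume "has_cusp z1 z2"
    then show "W t = 1 / golden_ratio"
      unfolding has_cusp_iff using pair_cusp_value[OF \<sigma>1] W_const[of t] by metis
  next
    assume w: "W t = 1 / golden_ratio"
    then obtain u where u: "X u = 0" "b u < a u" using zeros g by auto
    have "sgn (W u - 1 / golden_ratio) = 0"
      using w W_const[of t u] by (simp only: sgn_0_0 right_minus_eq)
    with pair_sgn_on_vertical(1)[OF \<sigma>1 u] have "Q1 u = 0" by (simp add: sgn_0_0)
    with u show "has_cusp z1 z2" unfolding has_cusp_iff by blast
  qed
  show "smooth_intertwining z1 z2 \<longleftrightarrow> 1 / golden_ratio < W t \<and> W t < 1"
  proof
    assume s: "smooth_intertwining z1 z2"
    then have graph: "graph_like z1" "graph_like z2" and "W t < 1"
      by (simp_all add: smooth_intertwining_def alt_iff)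
    moreover have "\<not> W t < 1 / golden_ratio"
      using turning turns_back_imp_not_graph_like(1) graph(1) by blast
    moreover have "W t \<noteq> 1 / golden_ratio"
      using graph unfolding cusp_iff[symmetric] has_cusp_iff graph_like_iff by blast
    ultimately show "1 / golden_ratio < W t \<and> W t < 1" by linarith
  next
    assume w: "1 / golden_ratio < W t \<and> W t < 1"
    have "Q1 s > 0 \<and> Q2 s > 0" for s
      using pair_velocity_nonneg(3)[OF \<sigma>1, of s] w W_const[of t s] by simp
    then have "graph_like z1" "graph_like z2"
      unfolding graph_like_iff by (metis less_irrefl)+
    with w show "smooth_intertwining z1 z2" by (simp add: smooth_intertwining_def alt_iff)
  qed
qed

lemma dipole_cusp_value:
  assumes \<sigma>1: "\<sigma> = - 1" and X: "X t = 0" and Q: "Q1 t = 0 \<or> Q2 t = 0"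
  shows "W t = golden_ratio"
proof -
  have "sgn (W t - golden_ratio) = 0"
    using on_vertical(4)[OF X] dipole_outer_positive[OF \<sigma>1, of t] dipole_sgn_on_vertical[OF \<sigma>1 X] Q
    by (metis less_irrefl linorder_neqE_linordered_idom sgn_0)
  then show ?thesis by (simp only: sgn_0_0 right_minus_eq)
qed

lemma dipole_classification:
  assumes \<sigma>1: "\<sigma> = - 1"
  shows "kink_motion z1 z2 \<longleftrightarrow> 1 < W t \<and> W t < golden_ratio"
    and "has_cusp z1 z2 \<longleftrightarrow> W t = golden_ratio"
    and "laminar_motion z1 z2 \<longleftrightarrow> golden_ratio < W t"
proof -
  note g = golden_ratio_gt_1
  have pass_iff: "vortices_pass z1 z2 \<longleftrightarrow> W t > 1"
    using vortices_pass_imp_zero dipole_W_gt_1(2)[OF \<sigma>1] dipole_pass(1)[OF \<sigma>1] W_const[of t]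
    by metis
  have zero: "\<exists>s. X s = 0" if "W t > 1"
    using that vortices_pass_imp_zero unfolding pass_iff[symmetric] by blast
  have kink: "turns_back z1 \<and> graph_like z2 \<or> graph_like z1 \<and> turns_back z2"
    if w: "1 < W t" "W t < golden_ratio"
  proof -
    obtain s where s: "X s = 0" using zero w by blast
    have sgn: "sgn (W s - golden_ratio) = - 1"
      using w W_const[of t s] by (simp only: sgn_1_neg diff_less_0_iff_less)
    obtain r where "2 * P\<^sup>2 \<le> S r" using dipole_pass(2)[OF \<sigma>1] w W_const[of t 0] by auto
    then have far: "Q1 r > 0 \<and> Q2 r > 0"
      using dipole_velocity_nonneg(3)[OF \<sigma>1, of r] w W_const[of t r] by simp
    from on_vertical(4)[OF s] consider "P > 0" | "P < 0" by linarith
    then show ?thesis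
    proof cases
      case 1
      with dipole_sgn_on_vertical(1)[OF \<sigma>1 s] sgn have "Q2 s < 0" by (simp add: sgn_1_neg)
      moreover have "Q1 u \<noteq> 0" for u using dipole_outer_positive(1)[OF \<sigma>1 1, of u] by simp
      ultimately show ?thesis unfolding turns_back_iff graph_like_iff using far by blast
    next
      case 2
      with dipole_sgn_on_vertical(2)[OF \<sigma>1 s] sgn have "Q1 s < 0" by (simp add: sgn_1_neg)
      moreover have "Q2 u \<noteq> 0" for u using dipole_outer_positive(2)[OF \<sigma>1 2, of u] by simp
      ultimately show ?thesis unfolding turns_back_iff graph_like_iff using far by blast
    qed
  qed
  have not_turning: "\<not> turns_back z1 \<and> \<not> turns_back z2" if "golden_ratio \<le> W t"
    unfolding turns_back_iff using dipole_velocity_nonneg(1)[OF \<sigma>1] that W_const[of t]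
    by (metis not_le)
  show "kink_motion z1 z2 \<longleftrightarrow> 1 < W t \<and> W t < golden_ratio"
    unfolding kink_motion_def pass_iff using kink not_turning by (meson not_le)
  show cusp_iff: "has_cusp z1 z2 \<longleftrightarrow> W t = golden_ratio"
  proof
    assume "has_cusp z1 z2"
    then show "W t = golden_ratio"
      unfolding has_cusp_iff using dipole_cusp_value[OF \<sigma>1] W_const[of t] by metis
  next
    assume w: "W t = golden_ratio"
    then obtain s where s: "X s = 0" using zero g by auto
    have "sgn (W s - golden_ratio) = 0"
      using w W_const[of t s] by (simp only: sgn_0_0 right_minus_eq)
    then have "Q1 s = 0 \<or> Q2 s = 0"
      using dipole_sgn_on_vertical[OF \<sigma>1 s] on_vertical(4)[OF s]
      by (metis linorder_neqE_linordered_idom sgn_0_0)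
    with s show "has_cusp z1 z2" unfolding has_cusp_iff by blast
  qed
  show "laminar_motion z1 z2 \<longleftrightarrow> golden_ratio < W t"
  proof
    assume "laminar_motion z1 z2"
    then have graph: "graph_like z1" "graph_like z2" and "W t > 1"
      by (simp_all add: laminar_motion_def pass_iff)
    moreover from this have "\<not> W t < golden_ratio"
      using kink turns_back_imp_not_graph_like by blast
    moreover have "W t \<noteq> golden_ratio"
      using graph unfolding cusp_iff[symmetric] has_cusp_iff graph_like_iff by blast
    ultimately show "golden_ratio < W t" by linarith
  next
    assume w: "golden_ratio < W t"
    have "Q1 s > 0 \<and> Q2 s > 0" for s
      using dipole_velocity_nonneg(2)[OF \<sigma>1, of s] w W_const[of t s] by simp
    then have "graph_like z1" "graph_like z2"
      unfolding graph_like_iff by (metis less_irrefl)+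
    with w g show "laminar_motion z1 z2" by (simp add: laminar_motion_def pass_iff)
  qed
qed

text \<open>
  On a common vertical the cross-ratio is \<open>4 * y1 * y2 / (y1 - y2)\<^sup>2\<close>, the reciprocal of \<open>W\<close> for a pair
  and of \<open>W - 1\<close> for a dipole.  Both \<open>1 / \<phi>\<close> and \<open>\<phi> - 1\<close> are the reciprocal of \<open>\<phi>\<close>.
\<close>

lemma cusp_position:
  assumes "velocity z1 t = 0 \<or> velocity z2 t = 0"
  shows "Re (z1 t) = Re (z2 t)"
    and "cross_ratio (Im (z1 t)) (Im (z2 t)) (Im (cnj (z2 t))) (Im (cnj (z1 t))) = golden_ratio"
proof -
  have X: "X t = 0" and Q: "Q1 t = 0 \<or> Q2 t = 0"
    using assms velocity_zero_imp by blast+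
  then show "Re (z1 t) = Re (z2 t)" by (simp add: X_def)
  define y1 y2 where "y1 = Im (z1 t)" and "y2 = Im (z2 t)"
  have y: "y1 > 0" "y2 > 0"
    using motion by (auto simp: vortex_motion_def y1_def y2_def)
  have "(y1 - y2)\<^sup>2 / (4 * y1 * y2) = golden_ratio - 1"
    using \<sigma>
  proof
    assume \<sigma>1: "\<sigma> = 1"
    have "b t = y2" "a t = y1" using pair_Im_z2[OF \<sigma>1] by (auto simp: y1_def y2_def a_def)
    with on_vertical(3)[OF X] pair_cusp_value[OF \<sigma>1 X Q] \<sigma>1 show ?thesis
      by (simp add: inverse_golden_ratio)
  next
    assume \<sigma>1: "\<sigma> = - 1"
    have "- b t = y2" "a t = y1" using Im_z2[of t] \<sigma>1 by (auto simp: y1_def y2_def a_def b_def)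
    then have "b t = - y2" "a t = y1" by auto
    with dipole_W_gt_1(1)[OF \<sigma>1 X] dipole_cusp_value[OF \<sigma>1 X Q] show ?thesis by simp
  qed
  then have "4 * y1 * y2 / (y1 - y2)\<^sup>2 = 1 / (golden_ratio - 1)"
    by (metis inverse_divide inverse_eq_divide)
  also have "\<dots> = golden_ratio"
    unfolding inverse_golden_ratio[symmetric] by simp
  finally show "cross_ratio (Im (z1 t)) (Im (z2 t)) (Im (cnj (z2 t))) (Im (cnj (z1 t))) = golden_ratio"
    by (simp add: cross_ratio_def y1_def y2_def power2_eq_square mult_ac)
qed

end

theorem theorem4:
  shows
    "((\<forall>w. 0 < w \<and> w < 1 \<longrightarrow>
         (\<exists>z1 z2. vortex_motion 1 1 z1 z2 \<and> (\<forall>t. interaction_parameter 1 1 (z1 t) (z2 t) = w))) \<and>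
      (\<forall>z1 z2 t w. vortex_motion 1 1 z1 z2 \<and> w = interaction_parameter 1 1 (z1 t) (z2 t) \<longrightarrow>
         (leap_frogging z1 z2 \<longleftrightarrow> w < 1 / golden_ratio) \<and>
         (has_cusp z1 z2 \<longleftrightarrow> w = 1 / golden_ratio) \<and>
         (smooth_intertwining z1 z2 \<longleftrightarrow> 1 / golden_ratio < w \<and> w < 1)))
     \<and>
     ((\<forall>w. 1 < w \<longrightarrow>
         (\<exists>z1 z2. vortex_motion 1 (-1) z1 z2 \<and>
            (\<forall>t. interaction_parameter 1 (-1) (z1 t) (z2 t) = w))) \<and>
      (\<forall>z1 z2 t w. vortex_motion 1 (-1) z1 z2 \<and> w = interaction_parameter 1 (-1) (z1 t) (z2 t) \<longrightarrow>
         (kink_motion z1 z2 \<longleftrightarrow> 1 < w \<and> w < golden_ratio) \<and>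
         (has_cusp z1 z2 \<longleftrightarrow> w = golden_ratio) \<and>
         (laminar_motion z1 z2 \<longleftrightarrow> golden_ratio < w)))
     \<and>
     (\<forall>z1 z2 t. (vortex_motion 1 1 z1 z2 \<or> vortex_motion 1 (-1) z1 z2) \<and>
         (velocity z1 t = 0 \<or> velocity z2 t = 0) \<longrightarrow>
         Re (z1 t) = Re (z2 t) \<and>
         cross_ratio (Im (z1 t)) (Im (z2 t)) (Im (cnj (z2 t))) (Im (cnj (z1 t))) = golden_ratio)"
proof (intro conjI allI impI; (elim conjE)?)
  fix w :: real
  assume "0 < w" "w < 1"
  then show "\<exists>z1 z2. vortex_motion 1 1 z1 z2 \<and> (\<forall>t. interaction_parameter 1 1 (z1 t) (z2 t) = w)"
    by (rule pair_motion_exists)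
next
  fix w :: real
  assume "1 < w"
  then show "\<exists>z1 z2. vortex_motion 1 (-1) z1 z2 \<and> (\<forall>t. interaction_parameter 1 (-1) (z1 t) (z2 t) = w)"
    by (rule dipole_motion_exists)
next
  fix z1 z2 t w
  assume m: "vortex_motion 1 1 z1 z2" and w: "w = interaction_parameter 1 1 (z1 t) (z2 t)"
  interpret mirror_motion 1 z1 z2 using m by unfold_locales simp_all
  note c = pair_classification[OF refl, of t, unfolded W_def, folded w]
  show "leap_frogging z1 z2 \<longleftrightarrow> w < 1 / golden_ratio" by (rule c)
  show "has_cusp z1 z2 \<longleftrightarrow> w = 1 / golden_ratio" by (rule c)
  show "smooth_intertwining z1 z2 \<longleftrightarrow> 1 / golden_ratio < w \<and> w < 1" by (rule c)
next
  fix z1 z2 t w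
  assume m: "vortex_motion 1 (-1) z1 z2" and w: "w = interaction_parameter 1 (-1) (z1 t) (z2 t)"
  interpret mirror_motion "- 1" z1 z2 using m by unfold_locales simp_all
  note c = dipole_classification[OF refl, of t, unfolded W_def, folded w]
  show "kink_motion z1 z2 \<longleftrightarrow> 1 < w \<and> w < golden_ratio" by (rule c)
  show "has_cusp z1 z2 \<longleftrightarrow> w = golden_ratio" by (rule c)
  show "laminar_motion z1 z2 \<longleftrightarrow> golden_ratio < w" by (rule c)
next
  fix z1 z2 t
  assume m: "vortex_motion 1 1 z1 z2 \<or> vortex_motion 1 (-1) z1 z2"
    and v: "velocity z1 t = 0 \<or> velocity z2 t = 0"
  from m obtain \<sigma> where "mirror_motion \<sigma> z1 z2"
    by (auto simp: mirror_motion_def)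
  then show "Re (z1 t) = Re (z2 t)"
    "cross_ratio (Im (z1 t)) (Im (z2 t)) (Im (cnj (z2 t))) (Im (cnj (z1 t))) = golden_ratio"
    using mirror_motion.cusp_position v by blast+
qed

end
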